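(* Let $N$ be a compact manifold without boundary, $N=M/\mathbb S^1$, and let $\varphi=\eta\wedge\omega+\Omega_+$ be an $\mathbb S^1$-invariant $G_2$-structure on $M$ satisfying $$d\Omega=\theta\wedge\Omega,\qquad d\omega=\tfrac23\theta\wedge\omega+\nu_3,\qquad d\eta=F_0^{1,1}+\lambda\omega.$$ Formally, if the reduced variables $(\lambda,\theta,\nu_3,F_0^{1,1})$ are varied independently, then the only critical point of the reduced $G_2$-Hilbert functional $$\mathcal F=-2\pi\int_N\Big(\tfrac{15}{8}\lambda^2+\tfrac5{18}|\theta|^2_{g_N}+\tfrac14|\nu_3|^2_{g_N}+\tfrac14|F_0^{1,1}|^2_{g_N}\Big)dV_{g_N}$$ is given by $$\lambda=0,\qquad\theta=0,\qquad\nu_3=0,\qquad F_0^{1,1}=0.$$ Equivalently, $d\eta=0$, $d\omega=0$, $d\Omega=0$. Thus the formal critical point corresponds to a flat connection over a transverse Calabi--Yau $SU(3)$-structure.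
   Context: $M$ is a $7$-manifold with a free $\mathbb S^1$-action; forms on $N$ are identified with their pullbacks to $M$. An $SU(3)$-structure on $N^6$ is a pair $(\omega,\Omega)$ with $\omega$ a real non-degenerate $2$-form and $\Omega=\Omega_++i\Omega_-$ a complex volume form satisfying $\omega\wedge\Omega_+=0$, $\frac16\omega^3=\frac14\Omega_+\wedge\Omega_-$, with induced Riemannian metric $g_N=\omega(\cdot,J\cdot)$, $J$ the almost complex structure determined by $\Omega_+$. Here $(\omega,\Omega)$ is an $SU(3)$-structure on $N$, $\eta$ is a connection $1$-form on $M\to N$ (the generator of the action has constant length $1$), $\lambda$ is a function on $N$, $\theta$ a real $1$-form on $N$, $\nu_3$ a primitive $3$-form of type $W_3$ ($\nu_3\wedge\omega=0$, $\nu_3\wedge\Omega_\pm=0$), and $F_0^{1,1}$ a primitive real $(1,1)$-form ($F_0^{1,1}\wedge\omega^2=0$, $F_0^{1,1}\wedge\Omega_+=0$). Norms are standard norms of differential forms. "Formal critical point" means: the first variation of $\mathcal F$ vanishes for all variations $(\dot\lambda,\dot\theta,\dot\nu_3,\dot F_0^{1,1})$ treated as independent (arbitrary smooth sections of the respective bundles, ignoring the differential constraints linking them). "Calabi--Yau" means $d\omega=0$ and $d\Omega=0$. *)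

theory Defs
  imports "HOL-Analysis.Analysis"
begin

section \<open>Smooth manifolds given by an atlas\<close>

text \<open>The following notion of a map of class \<open>C\<^sup>k\<close> is meant for open sets only.\<close>

primrec Ck_on :: "nat \<Rightarrow> 'e::euclidean_space set \<Rightarrow> ('e \<Rightarrow> 'f::real_normed_vector) \<Rightarrow> bool" where
  "Ck_on 0 S f \<longleftrightarrow> continuous_on S f"
| "Ck_on (Suc k) S f \<longleftrightarrow>
     (\<forall>x\<in>S. f differentiable (at x)) \<and> (\<forall>v. Ck_on k S (\<lambda>x. frechet_derivative f (at x) v))"

definition smooth_on :: "'e::euclidean_space set \<Rightarrow> ('e \<Rightarrow> 'f::real_normed_vector) \<Rightarrow> bool" where
  "smooth_on S f \<longleftrightarrow> (\<forall>k. Ck_on k S f)"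

text \<open>A chart is a pair of its domain and its coordinate map.  The whole type \<open>'p\<close> is the manifold.\<close>

type_synonym ('p, 'e) chart = "'p set \<times> ('p \<Rightarrow> 'e)"

definition cod :: "('p, 'e) chart \<Rightarrow> 'e set" where
  "cod c = snd c ` fst c"

definition pt :: "('p, 'e) chart \<Rightarrow> 'e \<Rightarrow> 'p" where
  "pt c = inv_into (fst c) (snd c)"

definition transition :: "('p, 'e) chart \<Rightarrow> ('p, 'e) chart \<Rightarrow> 'e \<Rightarrow> 'e" where
  "transition c c' = snd c' \<circ> pt c"

definition smooth_manifold ::
    "('p::{t2_space,second_countable_topology}, 'e::euclidean_space) chart set \<Rightarrow> bool" where
  "smooth_manifold A \<longleftrightarrow>
     (\<Union>c\<in>A. fst c) = UNIV \<and>
     (\<forall>c\<in>A. open (fst c) \<and> open (cod c) \<and> homeomorphism (fst c) (cod c) (snd c) (pt c)) \<and>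
     (\<forall>c\<in>A. \<forall>c'\<in>A. smooth_on (snd c ` (fst c \<inter> fst c')) (transition c c'))"

definition chart_at :: "('p, 'e) chart set \<Rightarrow> 'p \<Rightarrow> ('p, 'e) chart" where
  "chart_at A p = (SOME c. c \<in> A \<and> p \<in> fst c)"

definition euclidean_atlas :: "('e::euclidean_space, 'e) chart set" where
  "euclidean_atlas = {(UNIV, id)}"

definition prod_atlas ::
    "('p, 'e) chart set \<Rightarrow> ('q, 'f) chart set \<Rightarrow> ('p \<times> 'q, 'e \<times> 'f) chart set" where
  "prod_atlas A B = {(fst a \<times> fst b, map_prod (snd a) (snd b)) |a b. a \<in> A \<and> b \<in> B}"

definition smooth_map ::
    "('p::topological_space, 'e::euclidean_space) chart set \<Rightarrow>
     ('q::topological_space, 'f::euclidean_space) chart set \<Rightarrow> ('p \<Rightarrow> 'q) \<Rightarrow> bool" where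
  "smooth_map A B h \<longleftrightarrow>
     continuous_on UNIV h \<and>
     (\<forall>c\<in>A. \<forall>c'\<in>B. smooth_on (snd c ` (fst c \<inter> h -` fst c')) (snd c' \<circ> h \<circ> pt c))"


section \<open>Exterior algebra of a vector space\<close>

text \<open>A \<open>k\<close>-covector is a function of a sequence of vectors that only looks at the entries
  with index below \<open>k\<close>.  The wedge product is normalised so that
  \<open>(a \<and> b)(u, v) = a(u) b(v) - a(v) b(u)\<close> for covectors \<open>a\<close>, \<open>b\<close>.\<close>

definition alternating ::
    "nat \<Rightarrow> ((nat \<Rightarrow> 'e::real_vector) \<Rightarrow> 'r::real_vector) \<Rightarrow> bool" where
  "alternating k a \<longleftrightarrow>
     (\<forall>v w. (\<forall>i<k. v i = w i) \<longrightarrow> a v = a w) \<and>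
     (\<forall>v. \<forall>i<k. linear (\<lambda>u. a (v(i := u)))) \<and>
     (\<forall>v. \<forall>i<k. \<forall>j<k. i \<noteq> j \<and> v i = v j \<longrightarrow> a v = 0)"

definition wedge :: "nat \<Rightarrow> nat \<Rightarrow> ((nat \<Rightarrow> 'e) \<Rightarrow> 'r) \<Rightarrow> ((nat \<Rightarrow> 'e) \<Rightarrow> 'r) \<Rightarrow>
    (nat \<Rightarrow> 'e) \<Rightarrow> 'r::real_normed_field" where
  "wedge k l a b v =
     (\<Sum>s | s permutes {..<k + l}. of_int (sign s) * a (\<lambda>i. v (s i)) * b (\<lambda>i. v (s (k + i))))
       / (fact k * fact l)"

definition vec2 :: "'e \<Rightarrow> 'e \<Rightarrow> nat \<Rightarrow> 'e" where
  "vec2 u v = (\<lambda>i. if i = 0 then u else v)"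

definition vec3 :: "'e \<Rightarrow> 'e \<Rightarrow> 'e \<Rightarrow> nat \<Rightarrow> 'e" where
  "vec3 u v w = (\<lambda>i. if i = 0 then u else if i = 1 then v else w)"

definition gram :: "(real^'d \<Rightarrow> real^'d \<Rightarrow> real) \<Rightarrow> real^'d^'d" where
  "gram g = (\<chi> i j. g (axis i 1) (axis j 1))"

text \<open>Squared norm in coordinates:
  \<open>|a|\<^sup>2 = 1/k! \<Sum> g\<^bsup>i\<^sub>1 j\<^sub>1\<^esup> \<dots> g\<^bsup>i\<^sub>k j\<^sub>k\<^esup> a\<^bsub>i\<^sub>1\<dots>i\<^sub>k\<^esub> a\<^bsub>j\<^sub>1\<dots>j\<^sub>k\<^esub>\<close>,
  i.e. the sum of the squares of \<open>a(e\<^bsub>i\<^sub>1\<^esub>, \<dots>, e\<^bsub>i\<^sub>k\<^esub>)\<close> over \<open>i\<^sub>1 < \<dots> < i\<^sub>k\<close>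
  for any \<open>g\<close>-orthonormal basis.\<close>

definition covector_norm2 ::
    "nat \<Rightarrow> (real^'d \<Rightarrow> real^'d \<Rightarrow> real) \<Rightarrow> ((nat \<Rightarrow> real^'d) \<Rightarrow> real) \<Rightarrow> real" where
  "covector_norm2 k g a =
     (\<Sum>I \<in> {..<k} \<rightarrow>\<^sub>E UNIV. \<Sum>J \<in> {..<k} \<rightarrow>\<^sub>E UNIV.
        (\<Prod>m<k. matrix_inv (gram g) $ I m $ J m)
          * a (\<lambda>m. axis (I m) 1) * a (\<lambda>m. axis (J m) 1)) / fact k"


section \<open>Differential forms\<close>

text \<open>A form is represented by its coordinate expressions: \<open>\<alpha> c x\<close> is the covector at the
  coordinate point \<open>x\<close> of the chart \<open>c\<close>.  Values outside the atlas and outside \<open>cod c\<close> are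
  irrelevant, so that equality of forms is \<open>form_eq\<close> below.\<close>

type_synonym ('p, 'e, 'r) form = "('p, 'e) chart \<Rightarrow> 'e \<Rightarrow> (nat \<Rightarrow> 'e) \<Rightarrow> 'r"

definition smooth_form ::
    "('p, 'e::euclidean_space) chart set \<Rightarrow> nat \<Rightarrow> ('p, 'e, 'r::real_normed_vector) form \<Rightarrow> bool" where
  "smooth_form A k \<alpha> \<longleftrightarrow>
     (\<forall>c\<in>A. (\<forall>x\<in>cod c. alternating k (\<alpha> c x)) \<and> (\<forall>v. smooth_on (cod c) (\<lambda>x. \<alpha> c x v))) \<and>
     (\<forall>c\<in>A. \<forall>c'\<in>A. \<forall>x\<in>snd c ` (fst c \<inter> fst c'). \<forall>v.
        \<alpha> c x v = \<alpha> c' (transition c c' x) (\<lambda>i. frechet_derivative (transition c c') (at x) (v i)))"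

definition form_eq ::
    "('p, 'e) chart set \<Rightarrow> ('p, 'e, 'r) form \<Rightarrow> ('p, 'e, 'r) form \<Rightarrow> bool" where
  "form_eq A \<alpha> \<beta> \<longleftrightarrow> (\<forall>c\<in>A. \<forall>x\<in>cod c. \<forall>v. \<alpha> c x v = \<beta> c x v)"

definition form_zero :: "('p, 'e, 'r::zero) form" where
  "form_zero = (\<lambda>c x v. 0)"

definition form_add ::
    "('p, 'e, 'r::plus) form \<Rightarrow> ('p, 'e, 'r) form \<Rightarrow> ('p, 'e, 'r) form" where
  "form_add \<alpha> \<beta> = (\<lambda>c x v. \<alpha> c x v + \<beta> c x v)"

definition form_scale :: "real \<Rightarrow> ('p, 'e, 'r::real_vector) form \<Rightarrow> ('p, 'e, 'r) form" where
  "form_scale r \<alpha> = (\<lambda>c x v. r *\<^sub>R \<alpha> c x v)"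

definition fun_scale :: "('p \<Rightarrow> real) \<Rightarrow> ('p, 'e, 'r::real_vector) form \<Rightarrow> ('p, 'e, 'r) form" where
  "fun_scale f \<alpha> = (\<lambda>c x v. f (pt c x) *\<^sub>R \<alpha> c x v)"

definition form_Re :: "('p, 'e, complex) form \<Rightarrow> ('p, 'e, real) form" where
  "form_Re \<alpha> = (\<lambda>c x v. Re (\<alpha> c x v))"

definition form_Im :: "('p, 'e, complex) form \<Rightarrow> ('p, 'e, real) form" where
  "form_Im \<alpha> = (\<lambda>c x v. Im (\<alpha> c x v))"

definition form_complex :: "('p, 'e, real) form \<Rightarrow> ('p, 'e, complex) form" where
  "form_complex \<alpha> = (\<lambda>c x v. complex_of_real (\<alpha> c x v))"

definition form_wedge :: "nat \<Rightarrow> nat \<Rightarrow> ('p, 'e, 'r) form \<Rightarrow> ('p, 'e, 'r) form \<Rightarrow>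
    ('p, 'e, 'r::real_normed_field) form" where
  "form_wedge k l \<alpha> \<beta> = (\<lambda>c x. wedge k l (\<alpha> c x) (\<beta> c x))"

definition ext_d :: "nat \<Rightarrow> ('p, 'e::euclidean_space, 'r) form \<Rightarrow>
    ('p, 'e, 'r::real_normed_field) form" where
  "ext_d k \<alpha> = (\<lambda>c x v. \<Sum>i\<le>k. (-1) ^ i *
     frechet_derivative (\<lambda>y. \<alpha> c y (\<lambda>j. if j < i then v j else v (Suc j))) (at x) (v i))"

definition pullback :: "('q, 'f::euclidean_space) chart set \<Rightarrow> ('p \<Rightarrow> 'q) \<Rightarrow>
    ('q, 'f, 'r) form \<Rightarrow> ('p, 'e::euclidean_space, 'r) form" where
  "pullback B h \<alpha> = (\<lambda>c x v.
     let c' = chart_at B (h (pt c x)); h' = snd c' \<circ> h \<circ> pt c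
     in \<alpha> c' (h' x) (\<lambda>i. frechet_derivative h' (at x) (v i)))"


section \<open>Free circle actions and connections\<close>

text \<open>The circle is the set of complex numbers of modulus one; its fundamental vector field is
  taken with respect to the parametrisation \<open>cis\<close>, so that orbits have period \<open>2\<pi>\<close>.\<close>

definition free_circle_action ::
    "('m::{t2_space,second_countable_topology}, 'e::euclidean_space) chart set \<Rightarrow>
     (complex \<Rightarrow> 'm \<Rightarrow> 'm) \<Rightarrow> bool" where
  "free_circle_action A act \<longleftrightarrow>
     (\<forall>p. act 1 p = p) \<and>
     (\<forall>z w p. cmod z = 1 \<and> cmod w = 1 \<longrightarrow> act (z * w) p = act z (act w p)) \<and>
     (\<forall>z p. cmod z = 1 \<and> act z p = p \<longrightarrow> z = 1) \<and>
     smooth_map (prod_atlas (euclidean_atlas :: (real, real) chart set) A) A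
       (\<lambda>(t, p). act (cis t) p)"

definition quotient_projection ::
    "('m::{t2_space,second_countable_topology}, 'e::euclidean_space) chart set \<Rightarrow>
     (complex \<Rightarrow> 'm \<Rightarrow> 'm) \<Rightarrow>
     ('n::{t2_space,second_countable_topology}, 'f::euclidean_space) chart set \<Rightarrow>
     ('m \<Rightarrow> 'n) \<Rightarrow> bool" where
  "quotient_projection A act B proj \<longleftrightarrow>
     smooth_map A B proj \<and> surj proj \<and>
     (\<forall>p q. proj p = proj q \<longleftrightarrow> (\<exists>z. cmod z = 1 \<and> q = act z p)) \<and>
     (\<forall>c\<in>A. \<forall>c'\<in>B. \<forall>x\<in>snd c ` (fst c \<inter> proj -` fst c').
        surj (frechet_derivative (snd c' \<circ> proj \<circ> pt c) (at x)))"

definition generator :: "(complex \<Rightarrow> 'm \<Rightarrow> 'm) \<Rightarrow> ('m, 'e::euclidean_space) chart \<Rightarrow> 'e \<Rightarrow> 'e" where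
  "generator act c x = vector_derivative (\<lambda>t. snd c (act (cis t) (pt c x))) (at 0)"

definition circle_invariant ::
    "('m, 'e::euclidean_space) chart set \<Rightarrow> (complex \<Rightarrow> 'm \<Rightarrow> 'm) \<Rightarrow> ('m, 'e, 'r) form \<Rightarrow> bool" where
  "circle_invariant A act \<alpha> \<longleftrightarrow>
     (\<forall>z. cmod z = 1 \<longrightarrow> form_eq A (pullback A (act z) \<alpha>) \<alpha>)"

definition connection_form ::
    "('m, 'e::euclidean_space) chart set \<Rightarrow> (complex \<Rightarrow> 'm \<Rightarrow> 'm) \<Rightarrow> ('m, 'e, real) form \<Rightarrow> bool" where
  "connection_form A act \<eta> \<longleftrightarrow>
     smooth_form A 1 \<eta> \<and> circle_invariant A act \<eta> \<and>
     (\<forall>c\<in>A. \<forall>x\<in>cod c. \<eta> c x (\<lambda>_. generator act c x) = 1)"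

definition flat_connection ::
    "('m, 'e::euclidean_space) chart set \<Rightarrow> ('m, 'e, real) form \<Rightarrow> bool" where
  "flat_connection A \<eta> \<longleftrightarrow> form_eq A (ext_d 1 \<eta>) form_zero"


section \<open>\<open>G\<^sub>2\<close>-structures\<close>

definition e3 :: "7 \<Rightarrow> 7 \<Rightarrow> 7 \<Rightarrow> (nat \<Rightarrow> real^7) \<Rightarrow> real" where
  "e3 i j k = wedge 1 2 (\<lambda>v. v 0 $ i) (wedge 1 1 (\<lambda>v. v 0 $ j) (\<lambda>v. v 0 $ k))"

text \<open>The model form \<open>e\<^sup>1 \<and> \<omega>\<^sub>0 + Re \<Omega>\<^sub>0\<close> with \<open>\<omega>\<^sub>0 = e\<^sup>2\<^sup>3 + e\<^sup>4\<^sup>5 + e\<^sup>6\<^sup>7\<close> and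
  \<open>\<Omega>\<^sub>0 = (e\<^sup>2 + i e\<^sup>3) \<and> (e\<^sup>4 + i e\<^sup>5) \<and> (e\<^sup>6 + i e\<^sup>7)\<close>.\<close>

definition phi0 :: "(nat \<Rightarrow> real^7) \<Rightarrow> real" where
  "phi0 v = e3 1 2 3 v + e3 1 4 5 v + e3 1 6 7 v
          + e3 2 4 6 v - e3 2 5 7 v - e3 3 4 7 v - e3 3 5 6 v"

definition adapted_frame :: "((nat \<Rightarrow> real^7) \<Rightarrow> real) \<Rightarrow> (real^7 \<Rightarrow> real^7) \<Rightarrow> bool" where
  "adapted_frame a L \<longleftrightarrow> linear L \<and> bij L \<and> (\<forall>v. a v = phi0 (\<lambda>i. L (v i)))"

definition G2_structure :: "('m, real^7) chart set \<Rightarrow> ('m, real^7, real) form \<Rightarrow> bool" where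
  "G2_structure A \<phi> \<longleftrightarrow>
     smooth_form A 3 \<phi> \<and> (\<forall>c\<in>A. \<forall>x\<in>cod c. \<exists>L. adapted_frame (\<phi> c x) L)"

text \<open>Well defined because the stabiliser of \<open>phi0\<close> consists of isometries.\<close>

definition G2_metric :: "((nat \<Rightarrow> real^7) \<Rightarrow> real) \<Rightarrow> real^7 \<Rightarrow> real^7 \<Rightarrow> real" where
  "G2_metric a u v = (let L = (SOME L. adapted_frame a L) in L u \<bullet> L v)"


section \<open>\<open>SU(3)\<close>-structures\<close>

text \<open>The almost complex structure of a complex volume form \<open>\<Omega>\<close> is the one for which \<open>\<Omega>\<close> has
  type \<open>(3,0)\<close>; in terms of real and imaginary part
  \<open>\<Omega>\<^sub>-(u, v, w) = - \<Omega>\<^sub>+(J u, v, w)\<close>.  It is unique when \<open>\<Omega>\<close> does not vanish.\<close>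

definition acs_of_covector ::
    "((nat \<Rightarrow> real^6) \<Rightarrow> complex) \<Rightarrow> (real^6 \<Rightarrow> real^6) \<Rightarrow> bool" where
  "acs_of_covector a J \<longleftrightarrow>
     linear J \<and> (\<forall>u. J (J u) = - u) \<and>
     (\<forall>u v w. a (vec3 (J u) v w) = \<i> * a (vec3 u v w))"

definition acs :: "('n, real^6, complex) form \<Rightarrow> ('n, real^6) chart \<Rightarrow> real^6 \<Rightarrow> real^6 \<Rightarrow> real^6" where
  "acs \<Omega> c x = (THE J. acs_of_covector (\<Omega> c x) J)"

definition complex_volume_form :: "('n, real^6) chart set \<Rightarrow> ('n, real^6, complex) form \<Rightarrow> bool" where
  "complex_volume_form A \<Omega> \<longleftrightarrow>
     smooth_form A 3 \<Omega> \<and>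
     (\<forall>c\<in>A. \<forall>x\<in>cod c. (\<exists>v. \<Omega> c x v \<noteq> 0) \<and> (\<exists>J. acs_of_covector (\<Omega> c x) J))"

definition su3_metric :: "('n, real^6, real) form \<Rightarrow> ('n, real^6, complex) form \<Rightarrow>
    ('n, real^6) chart \<Rightarrow> real^6 \<Rightarrow> real^6 \<Rightarrow> real^6 \<Rightarrow> real" where
  "su3_metric \<omega> \<Omega> c x u v = \<omega> c x (vec2 u (acs \<Omega> c x v))"

definition SU3_structure ::
    "('n, real^6) chart set \<Rightarrow> ('n, real^6, real) form \<Rightarrow> ('n, real^6, complex) form \<Rightarrow> bool" where
  "SU3_structure A \<omega> \<Omega> \<longleftrightarrow>
     smooth_form A 2 \<omega> \<and>
     (\<forall>c\<in>A. \<forall>x\<in>cod c. \<forall>u. u \<noteq> 0 \<longrightarrow> (\<exists>v. \<omega> c x (vec2 u v) \<noteq> 0)) \<and>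
     complex_volume_form A \<Omega> \<and>
     form_eq A (form_wedge 2 3 \<omega> (form_Re \<Omega>)) form_zero \<and>
     form_eq A (form_scale (1/6) (form_wedge 2 4 \<omega> (form_wedge 2 2 \<omega> \<omega>)))
       (form_scale (1/4) (form_wedge 3 3 (form_Re \<Omega>) (form_Im \<Omega>))) \<and>
     (\<forall>c\<in>A. \<forall>x\<in>cod c.
        (\<forall>u v. su3_metric \<omega> \<Omega> c x u v = su3_metric \<omega> \<Omega> c x v u) \<and>
        (\<forall>u. u \<noteq> 0 \<longrightarrow> su3_metric \<omega> \<Omega> c x u u > 0))"

definition Calabi_Yau ::
    "('n, real^6) chart set \<Rightarrow> ('n, real^6, real) form \<Rightarrow> ('n, real^6, complex) form \<Rightarrow> bool" where
  "Calabi_Yau A \<omega> \<Omega> \<longleftrightarrow>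
     SU3_structure A \<omega> \<Omega> \<and>
     form_eq A (ext_d 2 \<omega>) form_zero \<and> form_eq A (ext_d 3 \<Omega>) form_zero"


section \<open>The reduced functional\<close>

text \<open>The Riemannian volume measure is the unique Borel measure with density
  \<open>sqrt (det (g\<^sub>i\<^sub>j))\<close> in every chart.\<close>

definition riemannian_volume :: "('n::topological_space, real^'d) chart set \<Rightarrow>
    (('n, real^'d) chart \<Rightarrow> real^'d \<Rightarrow> real^'d \<Rightarrow> real^'d \<Rightarrow> real) \<Rightarrow> 'n measure \<Rightarrow> bool" where
  "riemannian_volume A g \<mu> \<longleftrightarrow>
     sets \<mu> = sets borel \<and>
     (\<forall>c\<in>A. \<forall>B\<in>sets borel. B \<subseteq> fst c \<longrightarrow>
        emeasure \<mu> B =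
          (\<integral>\<^sup>+x. ennreal (sqrt (det (gram (g c x)))) * indicator (snd c ` B) x \<partial>lborel))"

text \<open>Independent of the choice of the chart, as the norm is invariant.\<close>

definition form_norm2 :: "('n, real^'d) chart set \<Rightarrow>
    (('n, real^'d) chart \<Rightarrow> real^'d \<Rightarrow> real^'d \<Rightarrow> real^'d \<Rightarrow> real) \<Rightarrow>
    nat \<Rightarrow> ('n, real^'d, real) form \<Rightarrow> 'n \<Rightarrow> real" where
  "form_norm2 A g k \<alpha> p =
     (let c = chart_at A p; x = snd c p in covector_norm2 k (g c x) (\<alpha> c x))"

text \<open>A real \<open>2\<close>-form \<open>F\<close> has type \<open>(1,1)\<close> iff \<open>F \<and> \<Omega>\<^sub>+ = 0\<close>.\<close>

definition reduced_variables ::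
    "('n::topological_space, real^6) chart set \<Rightarrow> ('n, real^6, real) form \<Rightarrow>
     ('n, real^6, complex) form \<Rightarrow> ('n \<Rightarrow> real) \<Rightarrow> ('n, real^6, real) form \<Rightarrow>
     ('n, real^6, real) form \<Rightarrow> ('n, real^6, real) form \<Rightarrow> bool" where
  "reduced_variables A \<omega> \<Omega> l \<theta> \<nu> F \<longleftrightarrow>
     smooth_map A (euclidean_atlas :: (real, real) chart set) l \<and>
     smooth_form A 1 \<theta> \<and>
     smooth_form A 3 \<nu> \<and>
     form_eq A (form_wedge 3 2 \<nu> \<omega>) form_zero \<and>
     form_eq A (form_wedge 3 3 \<nu> (form_Re \<Omega>)) form_zero \<and>
     form_eq A (form_wedge 3 3 \<nu> (form_Im \<Omega>)) form_zero \<and>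
     smooth_form A 2 F \<and>
     form_eq A (form_wedge 2 4 F (form_wedge 2 2 \<omega> \<omega>)) form_zero \<and>
     form_eq A (form_wedge 2 3 F (form_Re \<Omega>)) form_zero"

definition reduced_functional ::
    "('n, real^6) chart set \<Rightarrow> 'n measure \<Rightarrow> ('n, real^6, real) form \<Rightarrow>
     ('n, real^6, complex) form \<Rightarrow> ('n \<Rightarrow> real) \<Rightarrow> ('n, real^6, real) form \<Rightarrow>
     ('n, real^6, real) form \<Rightarrow> ('n, real^6, real) form \<Rightarrow> real" where
  "reduced_functional A vol \<omega> \<Omega> l \<theta> \<nu> F =
     (let g = su3_metric \<omega> \<Omega> in
      - 2 * pi * (\<integral>p. 15/8 * (l p)\<^sup>2 + 5/18 * form_norm2 A g 1 \<theta> p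
                    + 1/4 * form_norm2 A g 3 \<nu> p + 1/4 * form_norm2 A g 2 F p \<partial>vol))"

text \<open>The \<open>SU(3)\<close>-structure, and with it the metric and the volume, is kept fixed in the
  variation.\<close>

definition formal_critical_point ::
    "('n::topological_space, real^6) chart set \<Rightarrow> 'n measure \<Rightarrow> ('n, real^6, real) form \<Rightarrow>
     ('n, real^6, complex) form \<Rightarrow> ('n \<Rightarrow> real) \<Rightarrow> ('n, real^6, real) form \<Rightarrow>
     ('n, real^6, real) form \<Rightarrow> ('n, real^6, real) form \<Rightarrow> bool" where
  "formal_critical_point A vol \<omega> \<Omega> l \<theta> \<nu> F \<longleftrightarrow>
     (\<forall>l' \<theta>' \<nu>' F'. reduced_variables A \<omega> \<Omega> l' \<theta>' \<nu>' F' \<longrightarrow>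
        ((\<lambda>t. reduced_functional A vol \<omega> \<Omega> (\<lambda>p. l p + t * l' p)
                (form_add \<theta> (form_scale t \<theta>')) (form_add \<nu> (form_scale t \<nu>'))
                (form_add F (form_scale t F')))
          has_real_derivative 0) (at 0))"

definition all_zero ::
    "('n, real^6) chart set \<Rightarrow> ('n \<Rightarrow> real) \<Rightarrow> ('n, real^6, real) form \<Rightarrow>
     ('n, real^6, real) form \<Rightarrow> ('n, real^6, real) form \<Rightarrow> bool" where
  "all_zero A l \<theta> \<nu> F \<longleftrightarrow>
     (\<forall>p. l p = 0) \<and> form_eq A \<theta> form_zero \<and> form_eq A \<nu> form_zero \<and> form_eq A F form_zero"

end

theory Submission
  imports Defs
begin

text \<open>The functional is minus the integral of a positive definite quadratic form in the
  reduced variables. Varying a critical point in its own direction scales the integral by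
  \<open>(1 + t)\<^sup>2\<close>, so the integral vanishes. On the compact manifold the integrand is continuous and
  the volume is finite and positive on open sets, hence the integrand vanishes identically;
  its continuity rests on that of the almost complex structure, which solves a linear system of
  full rank with smooth coefficients. Conversely \<open>d\<eta> = 0\<close> gives \<open>F = - \<lambda>\<omega>\<close>, so \<open>\<lambda> \<omega>\<^sup>3 = 0\<close> and
  \<open>\<lambda> = 0\<close>. From \<open>\<theta> \<and> \<Omega> = 0\<close> one gets \<open>\<theta> = 0\<close>: contracting with \<open>J p\<close>, where \<open>\<Omega>(p, q, r)\<close> is
  not zero, yields \<open>\<theta>(J p) = \<i> \<theta>(p)\<close> for the real form \<open>\<theta>\<close>.\<close>

section \<open>Alternating sums and wedge products\<close>

text \<open>The critical variables are themselves an admissible direction, so one test variation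
  replaces localised ones and no pairing of bundles has to be set up. Three obstacles shape the
  analytic part. The norm at a point is evaluated in an arbitrarily chosen chart, so chart
  independence must precede continuity; orthonormal frames turn the inverse Gram formula into a
  visibly invariant sum of squares. The almost complex structure is given by a definite description,
  which says nothing about its dependence on the point; least squares expresses it through the
  coefficients of \<Omega>. A non-integrable function has integral 0 by convention, so integrability
  must be secured before a vanishing integral says anything. For the converse, \<omega>^3 must be
  shown non-zero from a wedge product defined as a sum over all permutations, 720 of them in degree
  six; a frame adapted to J makes most terms vanish, and the list recursion below lets them be
  discarded in whole branches.\<close>

text \<open>The sum of \<open>sign p * G (map p xs)\<close> over the permutations \<open>p\<close> of \<open>xs\<close>, unrolled along the image
  \<open>b\<close> of the head \<open>a\<close>: the remaining entries are permuted after \<open>b\<close> has been replaced by \<open>a\<close>.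
  In this form the simplifier can evaluate the sum and prune branches that vanish.\<close>

function altsum :: "nat list \<Rightarrow> (nat list \<Rightarrow> 'r::comm_ring_1) \<Rightarrow> 'r" where
  "altsum [] G = G []"
| "altsum (a # ys) G = altsum ys (\<lambda>zs. G (a # zs))
     - (\<Sum>b\<leftarrow>ys. altsum (map (Transposition.transpose a b) ys) (\<lambda>zs. G (b # zs)))"
  by pat_completeness auto
termination by (relation "Wellfounded.measure (\<lambda>(xs, G). length xs)") auto

lemma altsum_zero [simp]: "altsum xs (\<lambda>zs. 0 :: 'r::comm_ring_1) = 0"
proof (induction xs "\<lambda>zs::nat list. 0::'r" rule: altsum.induct)
  case (2 a ys)
  have "(\<Sum>b\<leftarrow>ys. altsum (map (Transposition.transpose a b) ys) (\<lambda>zs. 0 :: 'r)) = (\<Sum>b\<leftarrow>ys. 0)"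
    using 2(2) by (intro arg_cong[of _ _ sum_list] map_cong) auto
  then show ?case
    using 2(1) by simp
qed simp

text \<open>An injective \<open>f\<close> conjugates the transposition of \<open>a\<close> and
  \<open>b\<close> into that of \<open>f a\<close> and \<open>f b\<close>, so the recursion commutes
  with relabelling. This moves the transposition in \<open>transpose a b \<circ> q\<close> from the
  permutation onto the list.\<close>

lemma altsum_map: "altsum (map f xs) G = altsum xs (\<lambda>zs. G (map f zs))" if "inj f"
proof (induction "length xs" arbitrary: xs G rule: less_induct)
  case less
  show ?case
  proof (cases xs)
    case (Cons a ys)
    have tr: "map (Transposition.transpose (f a) (f b)) (map f ys)
        = map f (map (Transposition.transpose a b) ys)" for b
      using that by (auto simp: Transposition.transpose_def dest: injD)
    have IH: "altsum (map f zs) H = altsum zs (\<lambda>zs. H (map f zs))"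
      if "length zs = length ys" for zs and H :: "nat list \<Rightarrow> 'a"
      using less[of zs H] that Cons by simp
    have "altsum (map (Transposition.transpose (f a) (f b)) (map f ys)) H
        = altsum (map (Transposition.transpose a b) ys) (\<lambda>zs. H (map f zs))"
      for b and H :: "nat list \<Rightarrow> 'a"
      unfolding tr by (rule IH) simp
    then show ?thesis
      using IH[of ys] by (simp add: Cons o_def)
  qed simp
qed

text \<open>Every permutation of \<open>insert a S\<close> with \<open>a\<close> outside
  \<open>S\<close> is uniquely \<open>transpose a b \<circ> q\<close>, where \<open>b\<close> is the
  image of \<open>a\<close> and \<open>q\<close> permutes \<open>S\<close>. Since \<open>q\<close>
  fixes \<open>a\<close> and the transposition reverses the sign unless \<open>b = a\<close>, this
  is the recursion of \<open>altsum\<close>.\<close>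

lemma sum_permutes_altsum:
  fixes G :: "nat list \<Rightarrow> 'r::comm_ring_1"
  assumes "distinct xs"
  shows "(\<Sum>p | p permutes set xs. of_int (sign p) * G (map p xs)) = altsum xs G"
  using assms
proof (induction xs arbitrary: G)
  case Nil
  have "{p. p permutes {}} = {id :: nat \<Rightarrow> nat}"
    by (auto simp: permutes_empty)
  then show ?case
    by simp
next
  case (Cons a ys)
  have branch: "(\<Sum>q | q permutes set ys.
        of_int (sign (Transposition.transpose a b \<circ> q))
          * G (map (Transposition.transpose a b \<circ> q) (a # ys)))
      = (if a = b then 1 else - 1) * altsum (map (Transposition.transpose a b) ys) (\<lambda>zs. G (b # zs))"
    (is "?L b = _") for b
  proof -
    have "?L b = (\<Sum>q | q permutes set ys. (if a = b then 1 else - 1) *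
        (of_int (sign q) * G (b # map (Transposition.transpose a b) (map q ys))))"
    proof (rule sum.cong)
      fix q assume "q \<in> {q. q permutes set ys}"
      then have q: "q permutes set ys" by simp
      then have "q a = a"
        using Cons.prems by (simp add: permutes_not_in)
      moreover have "permutation q"
        using q by (auto simp: permutation_permutes)
      ultimately show "of_int (sign (Transposition.transpose a b \<circ> q)) * G (map (Transposition.transpose a b \<circ> q) (a # ys))
        = (if a = b then 1 else - 1) *
          (of_int (sign q) * G (b # map (Transposition.transpose a b) (map q ys)))"
        by (simp add: sign_compose permutation_swap_id sign_swap_id)
    qed simp
    also have "\<dots> = (if a = b then 1 else - 1) * altsum ys (\<lambda>zs. G (b # map (Transposition.transpose a b) zs))"
      using Cons.IH[of "\<lambda>zs. G (b # map (Transposition.transpose a b) zs)"] Cons.prems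
      by (simp add: sum_distrib_left[symmetric] sum_negf)
    also have "altsum ys (\<lambda>zs. G (b # map (Transposition.transpose a b) zs))
        = altsum (map (Transposition.transpose a b) ys) (\<lambda>zs. G (b # zs))"
      using altsum_map[of "Transposition.transpose a b" ys "\<lambda>zs. G (b # zs)"] by simp
    finally show ?thesis .
  qed
  have "(\<Sum>p | p permutes set (a # ys). of_int (sign p) * G (map p (a # ys)))
      = (\<Sum>b\<in>insert a (set ys). ?L b)"
    using Cons.prems
    by (subst list.set(2), intro sum_over_permutations_insert) simp_all
  also have "\<dots> = (\<Sum>b\<in>insert a (set ys).
      (if a = b then 1 else - 1) * altsum (map (Transposition.transpose a b) ys) (\<lambda>zs. G (b # zs)))"
    by (intro sum.cong refl branch)
  also have "\<dots> = altsum ys (\<lambda>zs. G (a # zs))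
      + (\<Sum>b\<in>set ys. - altsum (map (Transposition.transpose a b) ys) (\<lambda>zs. G (b # zs)))"
  proof -
    have "(\<Sum>b\<in>set ys.
      (if a = b then 1 else - 1) * altsum (map (Transposition.transpose a b) ys) (\<lambda>zs. G (b # zs))) =
      (\<Sum>b\<in>set ys. - altsum (map (Transposition.transpose a b) ys) (\<lambda>zs. G (b # zs)))"
      using Cons.prems by (intro sum.cong) auto
    then show ?thesis
      using Cons.prems by simp
  qed
  finally show ?case
    using Cons.prems
    by (simp add: sum_list_distinct_conv_sum_set sum_negf)
qed

lemma alternating_cong: "alternating k a \<Longrightarrow> (\<And>i. i < k \<Longrightarrow> v i = w i) \<Longrightarrow> a v = a w"
  unfolding alternating_def by blast

text \<open>The hypotheses say that \<open>a\<close> and \<open>b\<close> look only at their first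
  \<open>k\<close> and \<open>l\<close> arguments. They bridge the gap between \<open>s i\<close>,
  defined for every index, and list lookup, which is unspecified beyond the end of the list.\<close>

lemma wedge_eq_altsum:
  assumes a: "\<And>v w. (\<And>i. i < k \<Longrightarrow> v i = w i) \<Longrightarrow> a v = a w"
    and b: "\<And>v w. (\<And>i. i < l \<Longrightarrow> v i = w i) \<Longrightarrow> b v = b w"
  shows "wedge k l a b v = altsum [0..<k + l]
      (\<lambda>zs. a (\<lambda>i. v (zs ! i)) * b (\<lambda>i. v (zs ! (k + i)))) / (fact k * fact l)"
proof -
  have "wedge k l a b v = (\<Sum>s | s permutes set [0..<k + l]. of_int (sign s) *
      (a (\<lambda>i. v (map s [0..<k + l] ! i)) * b (\<lambda>i. v (map s [0..<k + l] ! (k + i)))))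
      / (fact k * fact l)"
    unfolding wedge_def
    using a[of "\<lambda>i. v (s i)" "\<lambda>i. v (map s [0..<k + l] ! i)" for s]
      b[of "\<lambda>i. v (s (k + i))" "\<lambda>i. v (map s [0..<k + l] ! (k + i))" for s]
    by (intro arg_cong2[of _ _ _ _ "(/)"] sum.cong) (auto simp: lessThan_atLeast0 mult.assoc)
  then show ?thesis
    using sum_permutes_altsum[of "[0..<k + l]"
        "\<lambda>zs. a (\<lambda>i. v (zs ! i)) * b (\<lambda>i. v (zs ! (k + i)))"] by simp
qed

section \<open>Alternating maps of two and three vectors, and wedge products in low degree\<close>

lemma alternating_vec2: "alternating 2 a \<Longrightarrow> a v = a (vec2 (v 0) (v 1))"
  by (rule alternating_cong, assumption) (auto simp: vec2_def less_Suc_eq numeral_2_eq_2)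

lemma alternating_vec3: "alternating 3 a \<Longrightarrow> a v = a (vec3 (v 0) (v 1) (v 2))"
  by (rule alternating_cong, assumption) (auto simp: vec3_def less_Suc_eq numeral_3_eq_3 numeral_2_eq_2)

lemma alternating_linear: "alternating k a \<Longrightarrow> i < k \<Longrightarrow> linear (\<lambda>u. a (v(i := u)))"
  unfolding alternating_def by blast

lemma alternating_eq_0: "alternating k a \<Longrightarrow> i < k \<Longrightarrow> j < k \<Longrightarrow> i \<noteq> j \<Longrightarrow> v i = v j \<Longrightarrow> a v = 0"
  unfolding alternating_def by blast

text \<open>Polarisation: \<open>a\<close> vanishes when both slots hold \<open>x + y\<close>, and
  expanding leaves only the two mixed terms.\<close>

lemma alternating_swap:
  assumes "alternating k a" and "i < k" and "j < k" and "i \<noteq> j"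
  shows "a (v(i := x, j := y)) = - a (v(i := y, j := x))"
proof -
  note li = linear_add[OF alternating_linear[OF assms(1,2)]]
  note lj = linear_add[OF alternating_linear[OF assms(1,3)]]
  have z: "a (v(i := z, j := z)) = 0" for z
    using assms by (intro alternating_eq_0[OF assms]) auto
  have "a (v(i := x + y, j := x + y)) = a (v(i := x + y, j := x)) + a (v(i := x + y, j := y))"
    by (rule lj)
  also have "\<dots> = a (v(j := x, i := x + y)) + a (v(j := y, i := x + y))"
    using assms(4) by (simp add: fun_upd_twist)
  also have "\<dots> = a (v(i := x, j := x)) + a (v(i := y, j := x)) + (a (v(i := x, j := y)) + a (v(i := y, j := y)))"
    using assms(4) by (simp add: li fun_upd_twist)
  finally show ?thesis
    by (simp add: z eq_neg_iff_add_eq_0 add.commute)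
qed

context
  fixes a :: "(nat \<Rightarrow> 'e::real_vector) \<Rightarrow> 'r::real_vector"
  assumes a: "alternating 2 a"
begin

lemma vec2_linear: "linear (\<lambda>u. a (vec2 u v))" "linear (\<lambda>v. a (vec2 u v))"
proof -
  have e: "a ((vec2 0 v)(0 := x)) = a (vec2 x v)" "a ((vec2 u 0)(1 := x)) = a (vec2 u x)" for x
    by (auto intro!: alternating_cong[OF a] simp: vec2_def)
  show "linear (\<lambda>u. a (vec2 u v))" "linear (\<lambda>v. a (vec2 u v))"
    using alternating_linear[OF a, of 0 "vec2 0 v"] alternating_linear[OF a, of 1 "vec2 u 0"]
    unfolding e by simp_all
qed

lemma vec2_swap: "a (vec2 u v) = - a (vec2 v u)"
proof -
  have "a (vec2 u v) = a ((\<lambda>_. v)(0 := u, 1 := v))" "a (vec2 v u) = a ((\<lambda>_. v)(0 := v, 1 := u))"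
    by (auto intro!: alternating_cong[OF a] simp: vec2_def)
  then show ?thesis
    using alternating_swap[OF a, of 0 1 "\<lambda>_. v" u v] by simp
qed

end

context
  fixes a :: "(nat \<Rightarrow> 'e::real_vector) \<Rightarrow> 'r::real_vector"
  assumes a: "alternating 3 a"
begin

lemma vec3_linear:
  "linear (\<lambda>u. a (vec3 u v w))" "linear (\<lambda>v. a (vec3 u v w))" "linear (\<lambda>w. a (vec3 u v w))"
proof -
  have e: "a ((vec3 0 v w)(0 := x)) = a (vec3 x v w)"
    "a ((vec3 u 0 w)(1 := x)) = a (vec3 u x w)" "a ((vec3 u v 0)(2 := x)) = a (vec3 u v x)" for x
    by (auto intro!: alternating_cong[OF a] simp: vec3_def)
  show "linear (\<lambda>u. a (vec3 u v w))" "linear (\<lambda>v. a (vec3 u v w))"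
    "linear (\<lambda>w. a (vec3 u v w))"
    using alternating_linear[OF a, of 0 "vec3 0 v w"] alternating_linear[OF a, of 1 "vec3 u 0 w"]
      alternating_linear[OF a, of 2 "vec3 u v 0"] unfolding e by simp_all
qed

lemma vec3_swap:
  "a (vec3 u v w) = - a (vec3 v u w)" "a (vec3 u v w) = - a (vec3 u w v)"
proof -
  have e: "a (vec3 x y z) = a ((\<lambda>_. w)(0 := x, 1 := y))" if "z = w" for x y z
    using that by (auto intro!: alternating_cong[OF a] simp: vec3_def)
  have e': "a (vec3 x y z) = a ((\<lambda>_. u)(1 := y, 2 := z))" if "x = u" for x y z
    using that by (auto intro!: alternating_cong[OF a] simp: vec3_def)
  show "a (vec3 u v w) = - a (vec3 v u w)"
    using alternating_swap[OF a, of 0 1 "\<lambda>_. w" u v] by (simp add: e)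
  show "a (vec3 u v w) = - a (vec3 u w v)"
    using alternating_swap[OF a, of 1 2 "\<lambda>_. u" v w] by (simp add: e')
qed

lemma vec3_same [simp]: "a (vec3 u u w) = 0" "a (vec3 u v v) = 0" "a (vec3 u v u) = 0"
proof -
  show "a (vec3 u u w) = 0" by (rule alternating_eq_0[OF a, of 0 1]) (auto simp: vec3_def)
  show "a (vec3 u v v) = 0" by (rule alternating_eq_0[OF a, of 1 2]) (auto simp: vec3_def)
  show "a (vec3 u v u) = 0" by (rule alternating_eq_0[OF a, of 0 2]) (auto simp: vec3_def)
qed

end

text \<open>The six orders of the arguments of \<open>b\<close> contribute equally once signs are
  counted and cancel the 3! of the normalisation; the expansion along the argument of
  \<open>a\<close> is left.\<close>

lemma wedge_1_3:
  fixes b :: "(nat \<Rightarrow> 'e::real_vector) \<Rightarrow> 'r::real_normed_field"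
  assumes "alternating 1 a" and "alternating 3 b"
  shows "wedge 1 3 a b v = a (\<lambda>_. v 0) * b (vec3 (v 1) (v 2) (v 3))
    - a (\<lambda>_. v 1) * b (vec3 (v 0) (v 2) (v 3))
    + a (\<lambda>_. v 2) * b (vec3 (v 0) (v 1) (v 3))
    - a (\<lambda>_. v 3) * b (vec3 (v 0) (v 1) (v 2))"
proof -
  define A where "A i = a (\<lambda>_. v i)" for i
  define B where "B i j k = b (vec3 (v i) (v j) (v k))" for i j k
  have upt: "[0..<4] = [0, Suc 0, 2, 3]"
    by (simp add: upt_conv_Cons)
  have e: "a (\<lambda>i. v (zs ! i)) = A (zs ! 0)"
    "b (\<lambda>i. v (zs ! (1 + i))) = B (zs ! (1 + 0)) (zs ! (1 + 1)) (zs ! (1 + 2))" for zs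
    unfolding A_def B_def
    by (rule alternating_cong[OF assms(1)], simp, rule alternating_vec3[OF assms(2)])
  have p: "B i k j = - B i j k" "B j i k = - B i j k"
    "B j k i = B i j k" "B k i j = B i j k" "B k j i = - B i j k" for i j k
    unfolding B_def using vec3_swap[OF assms(2)] by (metis add.inverse_inverse)+
  have "wedge 1 3 a b v = altsum [0..<4] (\<lambda>zs. A (zs ! 0) * B (zs ! (1 + 0)) (zs ! (1 + 1)) (zs ! (1 + 2))) / 6"
    using wedge_eq_altsum[of 1 a 3 b v, OF alternating_cong[OF assms(1)] alternating_cong[OF assms(2)]]
    unfolding e by (simp add: fact_numeral del: altsum.simps)
  also have "altsum [0..<4] (\<lambda>zs. A (zs ! 0) * B (zs ! (1 + 0)) (zs ! (1 + 1)) (zs ! (1 + 2))) =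
      6 * (A 0 * B 1 2 3 - A 1 * B 0 2 3 + A 2 * B 0 1 3 - A 3 * B 0 1 2)"
    \<comment> \<open>The antisymmetry rules are supplied only at increasing index triples, so each
      rewrites towards sorted order and none undoes another.\<close>
    by (simp add: upt Transposition.transpose_def
        p[where i = 0 and j = "Suc 0" and k = 2] p[where i = 0 and j = "Suc 0" and k = 3]
        p[where i = 0 and j = 2 and k = 3] p[where i = "Suc 0" and j = 2 and k = 3] algebra_simps)
  also have "6 * x / 6 = x" for x :: 'r
    by simp
  finally show ?thesis
    by (simp only: A_def B_def)
qed

text \<open>Four vectors split into two pairs in three ways, each arising from 8 permutations; the
  normalisation 2! 2! = 4 leaves the factor 2.\<close>

lemma wedge_2_2:
  fixes b :: "(nat \<Rightarrow> 'e::real_vector) \<Rightarrow> 'r::real_normed_field"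
  assumes "alternating 2 b"
  shows "wedge 2 2 b b v = 2 * (b (vec2 (v 0) (v 1)) * b (vec2 (v 2) (v 3))
    - b (vec2 (v 0) (v 2)) * b (vec2 (v 1) (v 3)) + b (vec2 (v 0) (v 3)) * b (vec2 (v 1) (v 2)))"
proof -
  define W where "W i j = b (vec2 (v i) (v j))" for i j
  have upt: "[0..<4] = [0, Suc 0, 2, 3]"
    by (simp add: upt_conv_Cons)
  have e: "b (\<lambda>i. v (zs ! i)) = W (zs ! 0) (zs ! 1)"
    "b (\<lambda>i. v (zs ! (2 + i))) = W (zs ! 2) (zs ! 3)" for zs
    unfolding W_def by (rule trans[OF alternating_vec2[OF assms]], simp)+
  have p: "W j i = - W i j" for i j
    unfolding W_def by (rule vec2_swap[OF assms])
  have "wedge 2 2 b b v = altsum [0..<4] (\<lambda>zs. W (zs ! 0) (zs ! 1) * W (zs ! 2) (zs ! 3)) / 4"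
    using wedge_eq_altsum[of 2 b 2 b v, OF alternating_cong[OF assms] alternating_cong[OF assms]]
    unfolding e by (simp add: fact_numeral del: altsum.simps)
  also have "altsum [0..<4] (\<lambda>zs. W (zs ! 0) (zs ! 1) * W (zs ! 2) (zs ! 3)) =
      8 * (W 0 1 * W 2 3 - W 0 2 * W 1 3 + W 0 3 * W 1 2)"
    by (simp add: upt Transposition.transpose_def p[of "Suc 0" 0] p[of 2 0] p[of 3 0]
        p[of 2 "Suc 0"] p[of 3 "Suc 0"] p[of 3 2] algebra_simps)
  also have "8 * x / 4 = 2 * x" for x :: 'r
    by simp
  finally show ?thesis
    by (simp only: W_def)
qed

text \<open>The frame splits into three mutually \<open>b\<close>-orthogonal planes. Of the choices
  for the two vectors fed to the first factor, only the 6 ordered pairs from one plane survive. Each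
  leaves 24 equal terms, in which the square \<open>P\<close> is twice the product of the two other
  pairings: 6 * 24 * 2 = 288. Dividing by 2! 4! = 48 gives six times a product of three positive
  numbers.\<close>

lemma wedge_cube_neq_0:
  fixes b :: "(nat \<Rightarrow> 'e::real_vector) \<Rightarrow> real"
  assumes b: "alternating 2 b"
    and pos: "b (vec2 (v 0) (v 1)) > 0" "b (vec2 (v 2) (v 3)) > 0" "b (vec2 (v 4) (v 5)) > 0"
    and zero: "\<And>i j. i < 6 \<Longrightarrow> j < 6 \<Longrightarrow> i div 2 \<noteq> j div 2 \<Longrightarrow> b (vec2 (v i) (v j)) = 0"
  shows "wedge 2 4 b (wedge 2 2 b b) v \<noteq> 0"
proof -
  define W where "W i j = b (vec2 (v i) (v j))" for i j
  define P where "P i j k l = 2 * (W i j * W k l - W i k * W j l + W i l * W j k)" for i j k l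
  have upt: "[0..<6] = [0, Suc 0, 2, 3, 4, 5]"
    by (simp add: upt_conv_Cons)
  have e: "b (\<lambda>i. v (zs ! i)) = W (zs ! 0) (zs ! 1)"
    "wedge 2 2 b b (\<lambda>i. v (zs ! (2 + i))) =
      P (zs ! (2 + 0)) (zs ! (2 + 1)) (zs ! (2 + 2)) (zs ! (2 + 3))" for zs
    unfolding P_def W_def by (rule alternating_vec2[OF b], rule wedge_2_2[OF b])
  have antisym: "W j i = - W i j" for i j
    unfolding W_def by (rule vec2_swap[OF b])
  have zeros: "W 0 2 = 0" "W 0 3 = 0" "W 0 4 = 0" "W 0 5 = 0"
    "W (Suc 0) 2 = 0" "W (Suc 0) 3 = 0" "W (Suc 0) 4 = 0" "W (Suc 0) 5 = 0"
    "W 2 0 = 0" "W 2 (Suc 0) = 0" "W 2 4 = 0" "W 2 5 = 0"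
    "W 3 0 = 0" "W 3 (Suc 0) = 0" "W 3 4 = 0" "W 3 5 = 0"
    "W 4 0 = 0" "W 4 (Suc 0) = 0" "W 4 2 = 0" "W 4 3 = 0"
    "W 5 0 = 0" "W 5 (Suc 0) = 0" "W 5 2 = 0" "W 5 3 = 0"
    unfolding W_def by (rule zero; simp)+
  have swap: "W (Suc 0) 0 = - W 0 (Suc 0)" "W 3 2 = - W 2 3" "W 5 4 = - W 4 5"
    by (rule antisym)+
  \<comment> \<open>\<open>P\<close> is totally antisymmetric, so all 24 orders of four distinct
    indices give the same signed term. Collapsing the inner sum in one rewrite avoids expanding all
    720 terms.\<close>
  have altsum_P: "altsum [i, j, k, l] (\<lambda>zs. c * P (zs ! 0) (zs ! Suc 0) (zs ! 2) (zs ! 3))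
      = 24 * (c * P i j k l)" if "distinct [i, j, k, l]" for i j k l c
  proof -
    have P: "P i j l k = - P i j k l" "P i k j l = - P i j k l" "P i k l j = P i j k l"
      "P i l j k = P i j k l" "P i l k j = - P i j k l" "P j i k l = - P i j k l" "P j i l k = P i j k l"
      "P j k i l = P i j k l" "P j k l i = - P i j k l" "P j l i k = - P i j k l" "P j l k i = P i j k l"
      "P k i j l = P i j k l" "P k i l j = - P i j k l" "P k j i l = - P i j k l" "P k j l i = P i j k l"
      "P k l i j = P i j k l" "P k l j i = - P i j k l" "P l i j k = - P i j k l" "P l i k j = P i j k l"
      "P l j i k = P i j k l" "P l j k i = - P i j k l" "P l k i j = - P i j k l" "P l k j i = P i j k l"
      by (simp_all add: P_def antisym[of j i] antisym[of k i]
          antisym[of l i] antisym[of k j] antisym[of l j] antisym[of l k] algebra_simps)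
    have "i \<noteq> j" "i \<noteq> k" "i \<noteq> l" "j \<noteq> k" "j \<noteq> l" "k \<noteq> l"
      using that by auto
    moreover note this[symmetric]
    ultimately show ?thesis
      by (simp add: Transposition.transpose_def P)
  qed
  \<comment> \<open>Restricted to length at least five, so that the simplifier leaves the rest to \<open>altsum_P\<close>.\<close>
  have altsum_long: "altsum (a # b # c # d # e # ys) G
      = altsum (b # c # d # e # ys) (\<lambda>zs. G (a # zs))
     - (\<Sum>x\<leftarrow>b # c # d # e # ys.
          altsum (map (Transposition.transpose a x) (b # c # d # e # ys)) (\<lambda>zs. G (x # zs)))"
    for a b c d e ys and G :: "nat list \<Rightarrow> real"
    by (rule altsum.simps)
  have local: "wedge 2 2 b b x = wedge 2 2 b b y" if "\<And>i. i < 4 \<Longrightarrow> x i = y i" for x y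
    using that by (simp add: wedge_2_2[OF b])
  have "wedge 2 4 b (wedge 2 2 b b) v = altsum [0..<6] (\<lambda>zs. W (zs ! 0) (zs ! 1) *
      P (zs ! (2 + 0)) (zs ! (2 + 1)) (zs ! (2 + 2)) (zs ! (2 + 3))) / 48"
    using wedge_eq_altsum[of 2 b 4 "wedge 2 2 b b" v, OF alternating_cong[OF b] local]
    unfolding e by (simp add: fact_numeral del: altsum.simps)
  also have "altsum [0..<6] (\<lambda>zs. W (zs ! 0) (zs ! 1) *
      P (zs ! (2 + 0)) (zs ! (2 + 1)) (zs ! (2 + 2)) (zs ! (2 + 3)))
     = 288 * (W 0 1 * W 2 3 * W 4 5)"
    by (simp add: upt Transposition.transpose_def altsum_long altsum_P swap zeros del: altsum.simps)
      (simp add: P_def swap zeros)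
  finally show ?thesis
    using pos by (simp add: W_def)
qed

section \<open>Norms of covectors\<close>

lemma sum_PiE_lessThan_Suc:
  "(\<Sum>P\<in>{..<Suc j} \<rightarrow>\<^sub>E (UNIV :: 'd::finite set). f P)
    = (\<Sum>P\<in>{..<j} \<rightarrow>\<^sub>E UNIV. \<Sum>y\<in>UNIV. f (P(j := y)))"
proof -
  have "(\<Sum>P\<in>{..<Suc j} \<rightarrow>\<^sub>E (UNIV :: 'd set). f P)
      = (\<Sum>(y, P)\<in>UNIV \<times> ({..<j} \<rightarrow>\<^sub>E UNIV). f (P(j := y)))"
    unfolding lessThan_Suc PiE_insert_eq
    by (subst sum.reindex[OF inj_combinator]) (auto intro!: sum.cong)
  also have "\<dots> = (\<Sum>P\<in>{..<j} \<rightarrow>\<^sub>E UNIV. \<Sum>y\<in>UNIV. f (P(j := y)))"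
    unfolding sum.cartesian_product[symmetric] by (rule sum.swap)
  finally show ?thesis .
qed

lemma alternating_expand:
  fixes a :: "(nat \<Rightarrow> 'e::real_vector) \<Rightarrow> 'r::real_vector" and b :: "'d::finite \<Rightarrow> 'e"
  assumes a: "alternating k a"
    and v: "\<And>m. m < k \<Longrightarrow> v m = (\<Sum>i\<in>UNIV. c m i *\<^sub>R b i)"
  shows "a v = (\<Sum>P\<in>{..<k} \<rightarrow>\<^sub>E UNIV. (\<Prod>m<k. c m (P m)) *\<^sub>R a (\<lambda>m. b (P m)))"
proof -
  \<comment> \<open>The first \<open>j\<close> slots already hold the basis vectors selected by
    \<open>P\<close>, the others still hold \<open>v\<close>; the induction step expands slot
    \<open>j\<close>.\<close>
  let ?w = "\<lambda>j P m. if m < j then b (P m) else v m"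
  have "j \<le> k \<Longrightarrow> a v = (\<Sum>P\<in>{..<j} \<rightarrow>\<^sub>E UNIV. (\<Prod>m<j. c m (P m)) *\<^sub>R a (?w j P))" for j
  proof (induction j)
    case (Suc j)
    have step: "a (?w j P) = (\<Sum>y\<in>UNIV. c j y *\<^sub>R a (?w (Suc j) (P(j := y))))" for P
    proof -
      have "linear (\<lambda>u. a ((?w j P)(j := u)))"
        using Suc.prems by (intro alternating_linear[OF a]) simp
      from linear_sum[OF this, of "\<lambda>y. c j y *\<^sub>R b y" UNIV] linear_scale[OF this]
      have "a ((?w j P)(j := \<Sum>y\<in>UNIV. c j y *\<^sub>R b y))
          = (\<Sum>y\<in>UNIV. c j y *\<^sub>R a ((?w j P)(j := b y)))"
        by simp
      moreover have "(?w j P)(j := \<Sum>y\<in>UNIV. c j y *\<^sub>R b y) = ?w j P"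
        using v[of j] Suc.prems by (auto simp: fun_eq_iff)
      moreover have "(?w j P)(j := b y) = ?w (Suc j) (P(j := y))" for y
        by (auto simp: fun_eq_iff less_Suc_eq)
      ultimately show ?thesis
        by simp
    qed
    have "a v = (\<Sum>P\<in>{..<j} \<rightarrow>\<^sub>E UNIV. (\<Prod>m<j. c m (P m)) *\<^sub>R a (?w j P))"
      using Suc by simp
    also have "\<dots> = (\<Sum>P\<in>{..<j} \<rightarrow>\<^sub>E UNIV. \<Sum>y\<in>UNIV.
        (\<Prod>m<Suc j. c m ((P(j := y)) m)) *\<^sub>R a (?w (Suc j) (P(j := y))))"
      unfolding step scaleR_sum_right by (intro sum.cong refl) simp
    finally show ?case
      by (subst sum_PiE_lessThan_Suc)
  qed simp
  then have "a v = (\<Sum>P\<in>{..<k} \<rightarrow>\<^sub>E UNIV. (\<Prod>m<k. c m (P m)) *\<^sub>R a (?w k P))"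
    by blast
  also have "\<dots> = (\<Sum>P\<in>{..<k} \<rightarrow>\<^sub>E UNIV. (\<Prod>m<k. c m (P m)) *\<^sub>R a (\<lambda>m. b (P m)))"
    by (intro sum.cong refl arg_cong2[of _ _ _ _ scaleR] alternating_cong[OF a]) simp
  finally show ?thesis .
qed

lemma matrix_inv_eqI:
  fixes A :: "'a::field^'n^'n"
  assumes "A ** X = mat 1"
  shows "matrix_inv A = X"
proof -
  have X: "X ** A = mat 1"
    using assms matrix_left_right_inverse by blast
  have "A ** matrix_inv A = mat 1 \<and> matrix_inv A ** A = mat 1"
    unfolding matrix_inv_def by (rule someI[of _ X]) (simp add: assms X)
  then show ?thesis
    by (metis X matrix_mul_assoc matrix_mul_lid matrix_mul_rid)
qed

lemma vec_axis_expansion: "v = (\<Sum>i\<in>UNIV. v $ i *\<^sub>R axis i 1)" for v :: "real^'d"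
  using basis_expansion[of v] by (simp add: scalar_mult_eq_scaleR)

text \<open>Each functional is the inner product with its coefficient vector; fewer vectors than the
  dimension span a proper subspace, which has a non-zero orthogonal vector. This count replaces
  Gram-Schmidt projections, both for orthonormal frames and for the frame adapted to
  \<open>J\<close>.\<close>

lemma exists_common_zero:
  fixes B :: "'a \<Rightarrow> real^'d \<Rightarrow> real"
  assumes "finite S" and "card S < CARD('d)" and lin: "\<And>s. s \<in> S \<Longrightarrow> linear (B s)"
  shows "\<exists>x. x \<noteq> 0 \<and> (\<forall>s\<in>S. B s x = 0)"
proof -
  let ?A = "\<lambda>s. \<chi> j. B s (axis j 1)"
  have "dim (?A ` S) < DIM(real^'d)"
    using dim_le_card'[of "?A ` S"] card_image_le[of S ?A] assms(1,2) by simp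
  then obtain x where x: "x \<noteq> 0" "\<And>y. y \<in> span (?A ` S) \<Longrightarrow> orthogonal x y"
    using orthogonal_to_subspace_exists by blast
  have "B s x = 0" if s: "s \<in> S" for s
  proof -
    have "B s x = x \<bullet> ?A s"
      by (subst vec_axis_expansion[of x])
        (simp add: linear_sum[OF lin[OF s]] linear_scale[OF lin[OF s]] inner_vec_def)
    then show ?thesis
      using x(2)[of "?A s"] s by (simp add: span_base orthogonal_def)
  qed
  then show ?thesis
    using x(1) by blast
qed

section \<open>Positive definite bilinear forms and orthonormal frames\<close>

locale inner_form =
  fixes g :: "real^'d \<Rightarrow> real^'d \<Rightarrow> real"
  assumes lin_left: "linear (\<lambda>u. g u v)"
    and sym: "g u v = g v u"
    and pos: "u \<noteq> 0 \<Longrightarrow> g u u > 0"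
begin

lemma lin_right: "linear (\<lambda>v. g u v)"
  using lin_left[of u] by (simp add: sym[of u])

lemma expand_left: "g u v = (\<Sum>r\<in>UNIV. u $ r * g (axis r 1) v)"
  by (subst vec_axis_expansion[of u]) (simp add: linear_sum[OF lin_left] linear_scale[OF lin_left])

lemma expand_right: "g u v = (\<Sum>r\<in>UNIV. v $ r * g u (axis r 1))"
  using expand_left[of v u] by (simp add: sym[of _ u])

definition orthonormal :: "('d \<Rightarrow> real^'d) \<Rightarrow> bool" where
  "orthonormal E \<longleftrightarrow> (\<forall>i j. g (E i) (E j) = (if i = j then 1 else 0))"

lemma exists_orthonormal: "\<exists>E. orthonormal E"
proof -
  have "\<exists>E. \<forall>i\<in>S. \<forall>j\<in>S. g (E i) (E j) = (if i = j then 1 else 0)" for S :: "'d set"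
    using finite[of S]
  proof (induction S)
    case (insert s S)
    then obtain E where E: "\<And>i j. i \<in> S \<Longrightarrow> j \<in> S \<Longrightarrow> g (E i) (E j) = (if i = j then 1 else 0)"
      by blast
    have "card S < CARD('d)"
      using insert by (intro psubset_card_mono) auto
    then obtain x where x: "x \<noteq> 0" and gx: "\<And>i. i \<in> S \<Longrightarrow> g x (E i) = 0"
      using exists_common_zero[of S "\<lambda>i u. g u (E i)"] insert.hyps lin_left by blast
    define y where "y = (1 / sqrt (g x x)) *\<^sub>R x"
    have "g y y = 1"
      using pos[OF x] by (simp add: y_def linear_scale[OF lin_left] linear_scale[OF lin_right])
    moreover have "g y (E i) = 0" "g (E i) y = 0" if "i \<in> S" for i
      using gx[OF that] sym[of "E i" y] by (simp_all add: y_def linear_scale[OF lin_left])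
    ultimately show ?case
      using E insert.hyps by (intro exI[of _ "E(s := y)"]) auto
  qed auto
  from this[of UNIV] show ?thesis
    by (auto simp: orthonormal_def)
qed

context
  fixes E assumes E: "orthonormal E"
begin

text \<open>With the frame as columns of \<open>B\<close>, orthonormality says
  \<open>transpose B ** gram g ** B = mat 1\<close>. One-sided inverses of square matrices are
  two-sided, so \<open>transpose B\<close> may move to the other end, which exhibits the inverse
  Gram matrix as \<open>B ** transpose B\<close>.\<close>

lemma gram_mult_frame: "gram g ** ((\<chi> r i. E i $ r) ** transpose (\<chi> r i. E i $ r)) = mat 1"
proof -
  let ?B = "\<chi> r i. E i $ r"
  have "transpose ?B ** (gram g ** ?B) = mat 1"
    using E
    by (simp add: vec_eq_iff matrix_matrix_mult_def transpose_def gram_def mat_def orthonormal_def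
        expand_left[of "E _"] expand_right[of "axis _ _" "E _"] sum_distrib_left mult_ac)
  then show ?thesis
    by (metis matrix_left_right_inverse matrix_mul_assoc)
qed

lemma matrix_inv_gram: "matrix_inv (gram g) $ r $ s = (\<Sum>i\<in>UNIV. E i $ r * E i $ s)"
  by (simp add: matrix_inv_eqI[OF gram_mult_frame] matrix_matrix_mult_def transpose_def)

lemma det_gram_pos: "det (gram g) > 0"
proof -
  let ?B = "\<chi> r i. E i $ r"
  have "det (gram g) * (det ?B)\<^sup>2 = 1"
    using arg_cong[OF gram_mult_frame, of det] by (simp add: det_mul power2_eq_square)
  then show ?thesis
    by (metis mult_pos_pos not_less_iff_gr_or_eq zero_less_one zero_less_power2 mult_neg_pos mult_zero_left less_asym zero_neq_one mult_zero_right zero_power2)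
qed

lemma expand_frame: "v = (\<Sum>i\<in>UNIV. g v (E i) *\<^sub>R E i)"
proof -
  let ?B = "\<chi> r i. E i $ r"
  have "(?B ** transpose ?B) ** gram g = mat 1"
    using gram_mult_frame matrix_left_right_inverse by blast
  then have "v = ?B *v (transpose ?B *v (gram g *v v))"
    by (simp add: matrix_vector_mul_assoc matrix_mul_assoc)
  also have "gram g *v v = (\<chi> r. g (axis r 1) v)"
    by (simp add: vec_eq_iff matrix_vector_mult_def gram_def expand_right[of "axis _ _" v] mult.commute)
  also have "transpose ?B *v (\<chi> r. g (axis r 1) v) = (\<chi> i. g v (E i))"
    by (simp add: vec_eq_iff matrix_vector_mult_def transpose_def expand_left[of "E _" v] sym[of v "E _"])
  also have "?B *v (\<chi> i. g v (E i)) = (\<Sum>i\<in>UNIV. g v (E i) *\<^sub>R E i)"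
    by (simp add: vec_eq_iff matrix_vector_mult_def mult.commute)
  finally show ?thesis .
qed

text \<open>Each entry of the inverse Gram matrix is a sum over the frame; multiplying out gives one
  sum over multi-indices \<open>I\<close>, and for fixed \<open>I\<close> the rest is the square of
  \<open>a\<close> at the frame vectors, expanded in coordinates. Definiteness and invariance of the
  norm both follow from this form.\<close>

lemma covector_norm2_frame:
  assumes a: "alternating k a"
  shows "covector_norm2 k g a = (\<Sum>I\<in>{..<k} \<rightarrow>\<^sub>E UNIV. (a (\<lambda>m. E (I m)))\<^sup>2) / fact k"
proof -
  let ?S = "{..<k} \<rightarrow>\<^sub>E (UNIV :: 'd set)"
  let ?x = "\<lambda>P. a (\<lambda>m. axis (P m) 1)"
  have "(\<Sum>I\<in>?S. (a (\<lambda>m. E (I m)))\<^sup>2)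
      = (\<Sum>I\<in>?S. \<Sum>P\<in>?S. \<Sum>Q\<in>?S. (\<Prod>m<k. E (I m) $ P m * E (I m) $ Q m) * ?x P * ?x Q)"
  proof (intro sum.cong refl)
    fix I
    have "a (\<lambda>m. E (I m)) = (\<Sum>P\<in>?S. (\<Prod>m<k. E (I m) $ P m) *\<^sub>R ?x P)"
      by (rule alternating_expand[OF a]) (rule vec_axis_expansion)
    then show "(a (\<lambda>m. E (I m)))\<^sup>2
        = (\<Sum>P\<in>?S. \<Sum>Q\<in>?S. (\<Prod>m<k. E (I m) $ P m * E (I m) $ Q m) * ?x P * ?x Q)"
      by (simp add: power2_eq_square sum_product prod.distrib mult_ac)
  qed
  also have "\<dots> = (\<Sum>P\<in>?S. \<Sum>I\<in>?S. \<Sum>Q\<in>?S.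
      (\<Prod>m<k. E (I m) $ P m * E (I m) $ Q m) * ?x P * ?x Q)"
    by (rule sum.swap)
  also have "\<dots> = (\<Sum>P\<in>?S. \<Sum>Q\<in>?S. \<Sum>I\<in>?S.
      (\<Prod>m<k. E (I m) $ P m * E (I m) $ Q m) * ?x P * ?x Q)"
    by (intro sum.cong refl sum.swap)
  also have "\<dots> = (\<Sum>P\<in>?S. \<Sum>Q\<in>?S. (\<Sum>I\<in>?S. \<Prod>m<k. E (I m) $ P m * E (I m) $ Q m) * ?x P * ?x Q)"
    by (simp add: sum_distrib_right)
  also have "\<dots> = (\<Sum>P\<in>?S. \<Sum>Q\<in>?S. (\<Prod>m<k. matrix_inv (gram g) $ P m $ Q m) * ?x P * ?x Q)"
    by (simp add: matrix_inv_gram prod_sum_PiE)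
  finally show ?thesis
    by (simp add: covector_norm2_def)
qed

end

lemma covector_norm2_nonneg: "alternating k a \<Longrightarrow> covector_norm2 k g a \<ge> 0"
  using exists_orthonormal by (auto simp: covector_norm2_frame intro!: divide_nonneg_pos sum_nonneg)

lemma covector_norm2_eq_0:
  assumes a: "alternating k a" and "covector_norm2 k g a = 0"
  shows "a v = 0"
proof -
  obtain E where E: "orthonormal E"
    using exists_orthonormal by blast
  have "a (\<lambda>m. E (I m)) = 0" if "I \<in> {..<k} \<rightarrow>\<^sub>E UNIV" for I
    using assms that by (simp add: covector_norm2_frame[OF E] sum_nonneg_eq_0_iff finite_PiE)
  then show ?thesis
    by (subst alternating_expand[OF a expand_frame[OF E]]) (auto intro!: sum.neutral)
qed

end

text \<open>\<open>D\<close> carries a \<open>g\<close>-orthonormal frame to an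
  \<open>h\<close>-orthonormal one, and \<open>a\<close> on the first equals \<open>b\<close> on the
  second.\<close>

lemma covector_norm2_pullback:
  fixes g h :: "real^'d \<Rightarrow> real^'d \<Rightarrow> real"
  assumes "inner_form g" and "inner_form h"
    and "\<And>u v. h (D u) (D v) = g u v"
    and "alternating k a" and "alternating k b" and "\<And>v. a v = b (\<lambda>m. D (v m))"
  shows "covector_norm2 k g a = covector_norm2 k h b"
proof -
  interpret g: inner_form g by fact
  interpret h: inner_form h by fact
  obtain E where E: "g.orthonormal E"
    using g.exists_orthonormal by blast
  then have "h.orthonormal (\<lambda>i. D (E i))"
    by (simp add: g.orthonormal_def h.orthonormal_def assms(3))
  then show ?thesis
    using g.covector_norm2_frame[OF E assms(4)] h.covector_norm2_frame[OF _ assms(5)]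
    by (simp add: assms(6))
qed

section \<open>Almost complex structures\<close>

lemma alternating_of_real:
  assumes t: "alternating k t"
  shows "alternating k (\<lambda>v. of_real (t v) :: 'r::{real_algebra_1, real_normed_vector})"
  unfolding alternating_def
proof (intro conjI allI impI)
  show "of_real (t v) = (of_real (t w) :: 'r)" if "\<forall>i<k. v i = w i" for v w
    using that by (intro arg_cong[of _ _ of_real] alternating_cong[OF t]) blast
  show "linear (\<lambda>u. of_real (t (v(i := u))) :: 'r)" if "i < k" for v i
    using linear_compose[OF alternating_linear[OF t that, of v], of "of_real :: real \<Rightarrow> 'r"]
    by (simp add: o_def linear_iff scaleR_conv_of_real)
  show "of_real (t v) = (0 :: 'r)" if "i < k" "j < k" "i \<noteq> j \<and> v i = v j" for v i j
    using that alternating_eq_0[OF t, of i j v] by simp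
qed

locale complex_3_covector =
  fixes a :: "(nat \<Rightarrow> real^6) \<Rightarrow> complex" and J :: "real^6 \<Rightarrow> real^6"
  assumes alt: "alternating 3 a"
    and nonzero: "\<exists>v. a v \<noteq> 0"
    and J: "acs_of_covector a J"
begin

lemma J_linear: "linear J" and J_J: "J (J u) = - u"
  and J_1: "a (vec3 (J u) v w) = \<i> * a (vec3 u v w)"
  using J by (auto simp: acs_of_covector_def)

lemma J_2: "a (vec3 u (J v) w) = \<i> * a (vec3 u v w)"
  using J_1[of v u w] vec3_swap(1)[OF alt, of u "J v" w] vec3_swap(1)[OF alt, of u v w] by simp

lemma J_3: "a (vec3 u v (J w)) = \<i> * a (vec3 u v w)"
  using J_2[of u w v] vec3_swap(2)[OF alt, of u v "J w"] vec3_swap(2)[OF alt, of u v w] by simp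

lemmas vec3_simps =
  linear_add[OF vec3_linear(1)[OF alt]] linear_add[OF vec3_linear(2)[OF alt]]
  linear_add[OF vec3_linear(3)[OF alt]] linear_diff[OF vec3_linear(1)[OF alt]]
  linear_scale[OF vec3_linear(1)[OF alt]] linear_scale[OF vec3_linear(2)[OF alt]]
  linear_scale[OF vec3_linear(3)[OF alt]] J_1 J_2 J_3
  vec3_same[OF alt]

lemma obtain_nonzero: obtains p q r where "a (vec3 p q r) \<noteq> 0"
  using nonzero alternating_vec3[OF alt] by metis

text \<open>Contraction with three vectors on which \<open>a\<close> does not vanish maps \<open>real^6\<close> onto
  \<open>complex^3\<close>, hence is injective for dimension reasons.\<close>

lemma injective:
  assumes "\<And>v w. a (vec3 u v w) = 0"
  shows "u = 0"
proof -
  obtain p q r where A: "a (vec3 p q r) \<noteq> 0"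
    by (rule obtain_nonzero)
  define L where "L u = (a (vec3 u q r), a (vec3 p u r), a (vec3 p q u))" for u
  have L: "linear L"
    by (rule linearI) (simp_all add: L_def vec3_simps)
  have "z \<in> range L" for z
  proof -
    obtain x y t where z: "z = (x, y, t)"
      by (cases z)
    \<comment> \<open>Multiplication by the complex number \<open>c\<close>, with \<open>J\<close>
      in the role of \<open>\<i>\<close>. As \<open>a\<close> is complex trilinear for it, each
      component of \<open>L\<close> can be prescribed separately.\<close>
    define m where "m c v = Re c *\<^sub>R v + Im c *\<^sub>R J v" for c v
    have m: "a (vec3 (m c u) v w) = c * a (vec3 u v w)"
      "a (vec3 u (m c v) w) = c * a (vec3 u v w)"
      "a (vec3 u v (m c w)) = c * a (vec3 u v w)" for c u v w
      by (simp_all add: m_def vec3_simps complex_eq_iff algebra_simps)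
    let ?A = "a (vec3 p q r)"
    have "z = L (m (x / ?A) p + m (y / ?A) q + m (t / ?A) r)"
      using A by (simp add: z L_def vec3_simps m)
    then show ?thesis
      by blast
  qed
  then have "surj L"
    by blast
  then have "inj L"
    by (intro linear_surjective_imp_injective[OF L]) simp_all
  moreover have "L u = L 0"
    using assms vec3_swap(1)[OF alt, of p u r] vec3_swap(1)[OF alt, of p u q]
      vec3_swap(2)[OF alt, of p q u] linear_0[OF L] by (simp add: L_def zero_prod_def)
  ultimately show ?thesis
    by (simp add: injD)
qed

lemma acs_unique: "J' = J" if "acs_of_covector a J'"
proof
  fix u
  have "a (vec3 (J' u - J u) v w) = 0" for v w
    using that by (simp add: vec3_simps acs_of_covector_def)
  then show "J' u = J u"
    using injective[of "J' u - J u"] by simp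
qed

lemma wedge_1_3_eq_0:
  assumes t: "alternating 1 t"
    and zero: "\<And>v. wedge 1 3 (\<lambda>v. complex_of_real (t v)) a v = 0"
  shows "t v = 0"
proof -
  obtain p q r where A: "a (vec3 p q r) \<noteq> 0"
    by (rule obtain_nonzero)
  define T where "T u = t (\<lambda>_. u)" for u
  have t': "alternating 1 (\<lambda>v. complex_of_real (t v))"
    by (rule alternating_of_real[OF t])
  have eq: "of_real (T u) * a (vec3 p q r) - of_real (T p) * a (vec3 u q r)
      + of_real (T q) * a (vec3 u p r) - of_real (T r) * a (vec3 u p q) = 0" for u
    using zero[of "\<lambda>i. if i = 0 then u else vec3 p q r (i - 1)"]
    unfolding wedge_1_3[OF t' alt] by (simp add: T_def vec3_def)
  have swaps: "a (vec3 q p r) = - a (vec3 p q r)" "a (vec3 r p q) = a (vec3 p q r)"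
    using vec3_swap[OF alt] by (metis minus_minus)+
  have real: "x = 0" if "of_real y * a (vec3 p q r) = of_real x * (\<i> * a (vec3 p q r))" for x y :: real
  proof -
    have "of_real y = of_real x * \<i>"
      using that A by (simp flip: mult.assoc)
    then show ?thesis
      by (simp add: complex_eq_iff)
  qed
  have "T p = 0"
    using eq[of "J p"] by (intro real[of "T (J p)"]) (simp add: vec3_simps)
  moreover have "T q = 0"
    using eq[of "J q"] by (intro real[of "T (J q)"]) (simp add: vec3_simps swaps)
  moreover have "T r = 0"
    using eq[of "J r"] by (intro real[of "T (J r)"]) (simp add: vec3_simps swaps)
  \<comment> \<open>With \<open>T\<close> zero on \<open>p\<close>, \<open>q\<close> and
    \<open>r\<close>, only the term of \<open>eq\<close> containing \<open>T u\<close>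
    survives.\<close>
  ultimately have "T u = 0" for u
    using eq[of u] A by simp
  moreover have "t v = T (v 0)"
    unfolding T_def by (rule alternating_cong[OF t]) simp
  ultimately show ?thesis
    by simp
qed

end

lemma vec2_comp: "(\<lambda>i. f (vec2 u v i)) = vec2 (f u) (f v)"
  by (auto simp: vec2_def)

lemma vec3_comp: "(\<lambda>i. f (vec3 u v w i)) = vec3 (f u) (f v) (f w)"
  by (auto simp: vec3_def)

text \<open>Both sides contract equally with \<open>b\<close> against vectors in the range of
  \<open>D\<close>. That suffices by \<open>injective\<close> for \<open>b\<close>, because
  \<open>D\<close> is onto: a kernel vector of \<open>D\<close> would be annihilated by
  \<open>a\<close>, so \<open>D\<close> is injective between spaces of the same dimension.\<close>

lemma acs_pullback:
  assumes "complex_3_covector a J" and "complex_3_covector b K" and D: "linear D"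
    and ab: "\<And>v. a v = b (\<lambda>i. D (v i))"
  shows "K (D u) = D (J u)"
proof -
  interpret a: complex_3_covector a J by fact
  interpret b: complex_3_covector b K by fact
  have ab3: "a (vec3 u v w) = b (vec3 (D u) (D v) (D w))" for u v w
    using ab[of "vec3 u v w"] by (simp add: vec3_comp)
  have "inj D"
    unfolding linear_injective_0[OF D]
  proof (intro allI impI)
    fix u assume "D u = 0"
    then show "u = 0"
      using linear_0[OF vec3_linear(1)[OF b.alt]] by (intro a.injective) (simp add: ab3)
  qed
  then have surj: "surj D"
    using linear_injective_imp_surjective[OF D] by simp
  have "b (vec3 (K (D u) - D (J u)) v w) = 0" for v w
  proof -
    obtain v' w' where "v = D v'" "w = D w'"
      using surj by (meson surjD)
    then show ?thesis
      using a.J_1[of u v' w'] by (simp add: b.vec3_simps ab3)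
  qed
  then show ?thesis
    using b.injective[of "K (D u) - D (J u)"] by simp
qed

text \<open>Three complex lines, spanned by \<open>e\<close> and \<open>J e\<close>, are chosen one
  after the other, each \<open>w\<close>-orthogonal to the previous ones. The third choice imposes
  four linear conditions, fewer than the dimension six. Positivity gives the non-zero pairing inside
  each line.\<close>

lemma exists_wedge_cube_neq_0:
  fixes w :: "(nat \<Rightarrow> real^6) \<Rightarrow> real"
  assumes w: "alternating 2 w" and J: "linear J" "\<And>u. J (J u) = - u"
    and sym: "\<And>u v. w (vec2 u (J v)) = w (vec2 v (J u))"
    and pos: "\<And>u. u \<noteq> 0 \<Longrightarrow> w (vec2 u (J u)) > 0"
  shows "\<exists>v. wedge 2 4 w (wedge 2 2 w w) v \<noteq> 0"
proof -
  define orth where "orth u v \<longleftrightarrow> w (vec2 u v) = 0 \<and> w (vec2 u (J v)) = 0" for u v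
  have lin: "linear (\<lambda>u. w (vec2 u v))" for v
    by (rule vec2_linear[OF w])
  have neg: "w (vec2 u (- v)) = - w (vec2 u v)" for u v
    by (rule linear_neg[OF vec2_linear(2)[OF w]])
  \<comment> \<open>Symmetry makes \<open>w\<close> invariant under \<open>J\<close>; hence the two
    conditions in \<open>orth\<close> already force all four pairings between the complex lines of
    \<open>u\<close> and \<open>v\<close> to vanish.\<close>
  have JJ: "w (vec2 (J u) (J v)) = w (vec2 u v)" "w (vec2 (J u) v) = - w (vec2 u (J v))" for u v
    using sym[of "J u" v] vec2_swap[OF w, of v u] vec2_swap[OF w, of "J u" v] sym[of u v]
    by (simp_all add: J(2) neg)
  have orthD: "w (vec2 x y) = 0"
    if "orth u v" "x \<in> {u, J u}" "y \<in> {v, J v}" for u v x y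
    using that JJ by (auto simp: orth_def)
  have orth_sym: "orth v u" if "orth u v" for u v
    using that vec2_swap[OF w, of u v] sym[of u v] by (simp add: orth_def)
  obtain e0 :: "real^6" where e0: "e0 \<noteq> 0"
    using axis_eq_0_iff[of 1 "1::real"] by (metis zero_neq_one)
  have "\<exists>x. x \<noteq> 0 \<and> (\<forall>s\<in>{e0, J e0}. w (vec2 x s) = 0)"
    using lin by (intro exists_common_zero) (auto simp: card_insert_if)
  then obtain e1 where e1: "e1 \<noteq> 0" "orth e1 e0"
    by (auto simp: orth_def)
  have "\<exists>x. x \<noteq> 0 \<and> (\<forall>s\<in>{e0, J e0, e1, J e1}. w (vec2 x s) = 0)"
    using lin by (intro exists_common_zero) (auto simp: card_insert_if)
  then obtain e2 where e2: "e2 \<noteq> 0" "orth e2 e0" "orth e2 e1"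
    by (auto simp: orth_def)
  define e where "e i = (if i = 0 then e0 else if i = 1 then e1 else e2)" for i :: nat
  \<comment> \<open>Consecutive vectors \<open>e i\<close> and \<open>J (e i)\<close> span one line
    over the complex numbers, so \<open>i div 2\<close> names the line containing
    \<open>v i\<close>.\<close>
  define v where "v i = (if even i then e (i div 2) else J (e (i div 2)))" for i
  have orth: "orth (e i) (e j)" if "i < 3" "j < 3" "i \<noteq> j" for i j
    using that e1 e2 orth_sym[OF e1(2)] orth_sym[OF e2(2)] orth_sym[OF e2(3)]
    by (auto simp: e_def less_Suc_eq numeral_3_eq_3)
  have "wedge 2 4 w (wedge 2 2 w w) v \<noteq> 0"
  proof (rule wedge_cube_neq_0[OF w])
    show "w (vec2 (v 0) (v 1)) > 0" "w (vec2 (v 2) (v 3)) > 0" "w (vec2 (v 4) (v 5)) > 0"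
      using e0 e1 e2 pos by (simp_all add: v_def e_def)
    show "w (vec2 (v i) (v j)) = 0" if "i < 6" "j < 6" "i div 2 \<noteq> j div 2" for i j
      using orth[of "i div 2" "j div 2"] that by (intro orthD[of "e (i div 2)" "e (j div 2)"]) (auto simp: v_def)
  qed
  then show ?thesis
    by blast
qed

section \<open>Continuity and change of charts\<close>

lemma smooth_on_continuous: "smooth_on S f \<Longrightarrow> continuous_on S f"
  unfolding smooth_on_def by (metis Ck_on.simps(1))

lemma smooth_on_differentiable: "smooth_on S f \<Longrightarrow> x \<in> S \<Longrightarrow> f differentiable (at x)"
  unfolding smooth_on_def by (metis Ck_on.simps(2))

lemma continuous_on_det:
  fixes A :: "'a::topological_space \<Rightarrow> real^'n^'n"
  assumes "\<And>i j. continuous_on S (\<lambda>x. A x $ i $ j)"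
  shows "continuous_on S (\<lambda>x. det (A x))"
  unfolding det_def by (intro continuous_intros assms)

text \<open>\<open>matrix_inv\<close> is defined by choice; Cramer's rule for column
  \<open>j\<close> of the inverse turns its entries into quotients of determinants, from which
  continuity can be read off.\<close>

lemma matrix_inv_cramer:
  fixes A :: "real^'n^'n"
  assumes "det A \<noteq> 0"
  shows "matrix_inv A $ i $ j = det (\<chi> r s. if s = i then axis j 1 $ r else A $ r $ s) / det A"
proof -
  obtain X where X: "A ** X = mat 1"
    using assms invertible_det_nz unfolding invertible_def by blast
  then have "A *v (matrix_inv A *v axis j 1) = axis j 1"
    by (simp add: matrix_inv_eqI matrix_vector_mul_assoc)
  then have "(matrix_inv A *v axis j 1) $ i
      = det (\<chi> r s. if s = i then axis j 1 $ r else A $ r $ s) / det A"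
    unfolding cramer[OF assms] by simp
  then show ?thesis
    by (simp add: matrix_vector_mult_basis column_def)
qed

lemma continuous_on_matrix_inv:
  fixes A :: "'a::topological_space \<Rightarrow> real^'n^'n"
  assumes A: "\<And>i j. continuous_on S (\<lambda>x. A x $ i $ j)" and nz: "\<And>x. x \<in> S \<Longrightarrow> det (A x) \<noteq> 0"
  shows "continuous_on S (\<lambda>x. matrix_inv (A x) $ i $ j)"
proof -
  have "continuous_on S (\<lambda>x. (\<chi> r s. if s = i then axis j 1 $ r else A x $ r $ s) $ k $ l)" for k l
    using A by (cases "l = i") auto
  then have "continuous_on S (\<lambda>x. det (\<chi> r s. if s = i then axis j 1 $ r else A x $ r $ s) / det (A x))"
    using A nz by (intro continuous_on_divide continuous_on_det) auto
  then show ?thesis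
    by (simp add: matrix_inv_cramer nz cong: continuous_on_cong)
qed

section \<open>The almost complex structure by least squares\<close>

context complex_3_covector
begin

text \<open>The equations \<open>a (J u, v, w) = \<i> a (u, v, w)\<close> are linear in \<open>J\<close>; the two Gram matrices
  below are those of their normal equations.\<close>

definition normal_matrix :: "real^6^6" where
  "normal_matrix = (\<chi> r s. \<Sum>k\<in>UNIV. \<Sum>l\<in>UNIV. a (vec3 (axis r 1) (axis k 1) (axis l 1))
      \<bullet> a (vec3 (axis s 1) (axis k 1) (axis l 1)))"

definition normal_rhs :: "real^6^6" where
  "normal_rhs = (\<chi> r s. \<Sum>k\<in>UNIV. \<Sum>l\<in>UNIV. a (vec3 (axis r 1) (axis k 1) (axis l 1))
      \<bullet> (\<i> * a (vec3 (axis s 1) (axis k 1) (axis l 1))))"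

lemma vec3_expand: "a (vec3 u v w) = (\<Sum>s\<in>UNIV. u $ s *\<^sub>R a (vec3 (axis s 1) v w))"
  by (subst vec_axis_expansion[of u])
    (simp add: linear_sum[OF vec3_linear(1)[OF alt]] linear_scale[OF vec3_linear(1)[OF alt]])

lemma normal_matrix_mult: "(normal_matrix *v u) $ r = (\<Sum>k\<in>UNIV. \<Sum>l\<in>UNIV. a (vec3 (axis r 1) (axis k 1) (axis l 1))
      \<bullet> a (vec3 u (axis k 1) (axis l 1)))"
proof -
  have "(normal_matrix *v u) $ r = (\<Sum>s\<in>UNIV. \<Sum>k\<in>UNIV. \<Sum>l\<in>UNIV.
      a (vec3 (axis r 1) (axis k 1) (axis l 1)) \<bullet> (u $ s *\<^sub>R a (vec3 (axis s 1) (axis k 1) (axis l 1))))"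
    by (simp add: matrix_vector_mult_def normal_matrix_def sum_distrib_left mult.commute)
  also have "\<dots> = (\<Sum>k\<in>UNIV. \<Sum>s\<in>UNIV. \<Sum>l\<in>UNIV.
      a (vec3 (axis r 1) (axis k 1) (axis l 1)) \<bullet> (u $ s *\<^sub>R a (vec3 (axis s 1) (axis k 1) (axis l 1))))"
    by (rule sum.swap)
  also have "\<dots> = (\<Sum>k\<in>UNIV. \<Sum>l\<in>UNIV. \<Sum>s\<in>UNIV.
      a (vec3 (axis r 1) (axis k 1) (axis l 1)) \<bullet> (u $ s *\<^sub>R a (vec3 (axis s 1) (axis k 1) (axis l 1))))"
    by (intro sum.cong refl sum.swap)
  finally show ?thesis
    by (subst vec3_expand[of u]) (simp only: inner_sum_right)
qed

text \<open>As a quadratic form at \<open>u\<close>, the matrix is the sum of the squared moduli of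
  \<open>a\<close> at \<open>u\<close> and two basis vectors. A kernel vector therefore contracts to
  zero with \<open>a\<close>, and \<open>injective\<close> applies.\<close>

lemma det_normal_matrix: "det normal_matrix \<noteq> 0"
proof -
  have "u = 0" if "normal_matrix *v u = 0" for u
  proof -
    let ?a = "\<lambda>k l u. a (vec3 u (axis k 1) (axis l 1))"
    have "0 = (\<Sum>r\<in>UNIV. u $ r * (normal_matrix *v u) $ r)"
      using that by simp
    also have "\<dots> = (\<Sum>r\<in>UNIV. \<Sum>k\<in>UNIV. \<Sum>l\<in>UNIV. (u $ r *\<^sub>R ?a k l (axis r 1)) \<bullet> ?a k l u)"
      by (simp add: normal_matrix_mult sum_distrib_left)
    also have "\<dots> = (\<Sum>k\<in>UNIV. \<Sum>r\<in>UNIV. \<Sum>l\<in>UNIV. (u $ r *\<^sub>R ?a k l (axis r 1)) \<bullet> ?a k l u)"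
      by (rule sum.swap)
    also have "\<dots> = (\<Sum>k\<in>UNIV. \<Sum>l\<in>UNIV. \<Sum>r\<in>UNIV. (u $ r *\<^sub>R ?a k l (axis r 1)) \<bullet> ?a k l u)"
      by (intro sum.cong refl sum.swap)
    also have "\<dots> = (\<Sum>k\<in>UNIV. \<Sum>l\<in>UNIV. ?a k l u \<bullet> ?a k l u)"
      by (simp only: inner_sum_left[symmetric] vec3_expand[symmetric])
    finally have "(\<Sum>k\<in>UNIV. \<Sum>l\<in>UNIV. ?a k l u \<bullet> ?a k l u) = 0"
      by simp
    then have z: "?a k l u = 0" for k l
      by (simp add: sum_nonneg_eq_0_iff sum_nonneg)
    have "a (vec3 u v w) = 0" for v w
    proof -
      have "a (vec3 u v w) = (\<Sum>s\<in>UNIV. v $ s *\<^sub>R a (vec3 u (axis s 1) w))"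
        by (subst vec_axis_expansion[of v])
          (simp add: linear_sum[OF vec3_linear(2)[OF alt]] linear_scale[OF vec3_linear(2)[OF alt]])
      moreover have "a (vec3 u v' w) = (\<Sum>s\<in>UNIV. w $ s *\<^sub>R a (vec3 u v' (axis s 1)))" for v'
        by (subst vec_axis_expansion[of w])
          (simp add: linear_sum[OF vec3_linear(3)[OF alt]] linear_scale[OF vec3_linear(3)[OF alt]])
      ultimately show ?thesis
        by (simp add: z)
    qed
    then show "u = 0"
      by (rule injective)
  qed
  then have "\<exists>B. B ** normal_matrix = mat 1"
    using matrix_left_invertible_ker by blast
  then show ?thesis
    using invertible_det_nz invertible_left_inverse by blast
qed

text \<open>\<open>J\<close> solves the overdetermined system exactly, hence also its normal
  equations, whose matrix is invertible. The right-hand side no longer mentions \<open>J\<close>,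
  only the coefficients of \<open>a\<close>.\<close>

lemma J_eq: "J (axis s 1) $ r = (\<Sum>t\<in>UNIV. matrix_inv normal_matrix $ r $ t * normal_rhs $ t $ s)"
proof -
  have PJ: "normal_matrix *v J (axis s 1) = (\<chi> t. normal_rhs $ t $ s)"
    by (simp add: vec_eq_iff normal_matrix_mult J_1 normal_rhs_def)
  obtain X where X: "normal_matrix ** X = mat 1"
    using det_normal_matrix invertible_det_nz unfolding invertible_def by blast
  then have "matrix_inv normal_matrix ** normal_matrix = mat 1"
    using matrix_inv_eqI matrix_left_right_inverse by metis
  then have "J (axis s 1) = matrix_inv normal_matrix *v (\<chi> t. normal_rhs $ t $ s)"
    unfolding PJ[symmetric] by (simp add: matrix_vector_mul_assoc)
  then show ?thesis
    by (simp add: matrix_vector_mult_def)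
qed

end

section \<open>Points, coordinates and change of charts\<close>

lemma snd_in: "p \<in> fst c \<Longrightarrow> snd c p \<in> cod c"
  by (auto simp: cod_def)

context
  fixes N :: "('p::{t2_space,second_countable_topology}, 'e::euclidean_space) chart set"
  assumes N: "smooth_manifold N"
begin

lemma linear_transition:
  assumes "c \<in> N" and "c' \<in> N" and "x \<in> snd c ` (fst c \<inter> fst c')"
  shows "linear (frechet_derivative (transition c c') (at x))"
proof -
  have "transition c c' differentiable (at x)"
    using N assms unfolding smooth_manifold_def by (blast intro: smooth_on_differentiable)
  then show ?thesis
    by (rule linear_frechet_derivative)
qed

lemma pt_snd: "c \<in> N \<Longrightarrow> p \<in> fst c \<Longrightarrow> pt c (snd c p) = p"
  using N by (auto simp: smooth_manifold_def homeomorphism_def)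

lemma pt_in: "c \<in> N \<Longrightarrow> x \<in> cod c \<Longrightarrow> pt c x \<in> fst c \<and> snd c (pt c x) = x"
  using N by (auto simp: smooth_manifold_def homeomorphism_def)

lemma chart_at: "chart_at N p \<in> N \<and> p \<in> fst (chart_at N p)"
proof -
  obtain c where "c \<in> N \<and> p \<in> fst c"
    using N unfolding smooth_manifold_def by blast
  then show ?thesis
    unfolding chart_at_def by (rule someI)
qed

lemma smooth_form_transition:
  assumes \<alpha>: "smooth_form N k \<alpha>" and c: "c \<in> N" "c' \<in> N" and p: "p \<in> fst c" "p \<in> fst c'"
  shows "\<alpha> c (snd c p) v
    = \<alpha> c' (snd c' p) (\<lambda>i. frechet_derivative (transition c c') (at (snd c p)) (v i))"
proof -
  have "snd c p \<in> snd c ` (fst c \<inter> fst c')"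
    using p by blast
  then have "\<alpha> c (snd c p) v = \<alpha> c' (transition c c' (snd c p))
      (\<lambda>i. frechet_derivative (transition c c') (at (snd c p)) (v i))"
    using \<alpha> c unfolding smooth_form_def by blast
  moreover have "transition c c' (snd c p) = snd c' p"
    using pt_snd[OF c(1) p(1)] by (simp add: transition_def)
  ultimately show ?thesis
    by simp
qed

end

section \<open>Metric, norms and their continuity for an SU(3)-structure\<close>

context
  fixes N :: "('n::{t2_space,second_countable_topology}, real^6) chart set"
    and \<omega> :: "('n, real^6, real) form" and \<Omega> :: "('n, real^6, complex) form"
  assumes SU3: "SU3_structure N \<omega> \<Omega>"
begin

text \<open>\<open>acs\<close> is a definite description: existence is part of
  \<open>complex_volume_form\<close>, and uniqueness is \<open>acs_unique\<close>.\<close>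

lemma SU3_complex_3_covector:
  assumes "c \<in> N" and "x \<in> cod c"
  shows "complex_3_covector (\<Omega> c x) (acs \<Omega> c x)"
proof -
  have alt: "alternating 3 (\<Omega> c x)" and nz: "\<exists>v. \<Omega> c x v \<noteq> 0"
    and ex: "\<exists>J. acs_of_covector (\<Omega> c x) J"
    using SU3 assms by (auto simp: SU3_structure_def complex_volume_form_def smooth_form_def)
  obtain J where J: "acs_of_covector (\<Omega> c x) J"
    using ex by blast
  then interpret complex_3_covector "\<Omega> c x" J
    using alt nz by unfold_locales
  have "acs \<Omega> c x = J"
    unfolding acs_def using J acs_unique by (rule the_equality)
  then show ?thesis
    by (simp add: complex_3_covector_axioms)
qed

lemma SU3_alternating: "c \<in> N \<Longrightarrow> x \<in> cod c \<Longrightarrow> alternating 2 (\<omega> c x)"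
  using SU3 by (auto simp: SU3_structure_def smooth_form_def)

lemma SU3_inner_form:
  assumes "c \<in> N" and "x \<in> cod c"
  shows "inner_form (su3_metric \<omega> \<Omega> c x)"
proof (rule inner_form.intro)
  show "linear (\<lambda>u. su3_metric \<omega> \<Omega> c x u v)" for v
    unfolding su3_metric_def by (rule vec2_linear[OF SU3_alternating[OF assms]])
  show "su3_metric \<omega> \<Omega> c x u v = su3_metric \<omega> \<Omega> c x v u" for u v
    using SU3 assms unfolding SU3_structure_def by blast
  show "u \<noteq> 0 \<Longrightarrow> su3_metric \<omega> \<Omega> c x u u > 0" for u
    using SU3 assms unfolding SU3_structure_def by blast
qed

lemma SU3_cube_neq_0:
  assumes "c \<in> N" and "x \<in> cod c"
  shows "\<exists>v. wedge 2 4 (\<omega> c x) (wedge 2 2 (\<omega> c x) (\<omega> c x)) v \<noteq> 0"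
proof -
  interpret complex_3_covector "\<Omega> c x" "acs \<Omega> c x"
    by (rule SU3_complex_3_covector[OF assms])
  interpret inner_form "su3_metric \<omega> \<Omega> c x"
    by (rule SU3_inner_form[OF assms])
  show ?thesis
    using sym pos unfolding su3_metric_def
    by (intro exists_wedge_cube_neq_0[OF SU3_alternating[OF assms] J_linear J_J])
qed

lemma continuous_on_acs:
  assumes c: "c \<in> N"
  shows "continuous_on (cod c) (\<lambda>x. acs \<Omega> c x (axis s 1) $ r)"
proof -
  note cov = SU3_complex_3_covector[OF c]
  have Om: "continuous_on (cod c) (\<lambda>x. \<Omega> c x v)" for v
    using SU3 c by (auto simp: SU3_structure_def complex_volume_form_def smooth_form_def
        intro!: smooth_on_continuous)
  \<comment> \<open>Outside the locale these matrices take only the covector as argument, so their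
    entries are polynomials in the coefficients of \<open>\<Omega>\<close>.\<close>
  define P where "P x = complex_3_covector.normal_matrix (\<Omega> c x)" for x
  define H where "H x = complex_3_covector.normal_rhs (\<Omega> c x)" for x
  have P: "continuous_on (cod c) (\<lambda>x. P x $ i $ j)" for i j
    by (simp add: P_def complex_3_covector.normal_matrix_def[OF cov] cong: continuous_on_cong)
      (intro continuous_intros Om)
  have H: "continuous_on (cod c) (\<lambda>x. H x $ i $ j)" for i j
    by (simp add: H_def complex_3_covector.normal_rhs_def[OF cov] cong: continuous_on_cong)
      (intro continuous_intros Om)
  have "continuous_on (cod c) (\<lambda>x. \<Sum>t\<in>UNIV. matrix_inv (P x) $ r $ t * H x $ t $ s)"
    using complex_3_covector.det_normal_matrix[OF cov]
    by (intro continuous_intros continuous_on_matrix_inv P H) (simp add: P_def)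
  then show ?thesis
    by (simp add: complex_3_covector.J_eq[OF cov] P_def H_def cong: continuous_on_cong)
qed

lemma continuous_on_gram:
  assumes c: "c \<in> N"
  shows "continuous_on (cod c) (\<lambda>x. gram (su3_metric \<omega> \<Omega> c x) $ i $ j)"
proof -
  have om: "continuous_on (cod c) (\<lambda>x. \<omega> c x v)" for v
    using SU3 c by (auto simp: SU3_structure_def smooth_form_def intro!: smooth_on_continuous)
  have eq: "gram (su3_metric \<omega> \<Omega> c x) $ i $ j
      = (\<Sum>k\<in>UNIV. acs \<Omega> c x (axis j 1) $ k * \<omega> c x (vec2 (axis i 1) (axis k 1)))"
    if x: "x \<in> cod c" for x
  proof -
    note lin = vec2_linear(2)[OF SU3_alternating[OF c x]]
    have "\<omega> c x (vec2 u v) = (\<Sum>k\<in>UNIV. v $ k * \<omega> c x (vec2 u (axis k 1)))" for u v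
      by (subst vec_axis_expansion[of v]) (simp add: linear_sum[OF lin] linear_scale[OF lin])
    from this[of "axis i 1" "acs \<Omega> c x (axis j 1)"] show ?thesis
      unfolding gram_def su3_metric_def by simp
  qed
  have "continuous_on (cod c)
      (\<lambda>x. \<Sum>k\<in>UNIV. acs \<Omega> c x (axis j 1) $ k * \<omega> c x (vec2 (axis i 1) (axis k 1)))"
    by (intro continuous_intros continuous_on_acs c om)
  then show ?thesis
    by (simp add: eq cong: continuous_on_cong)
qed

lemma det_gram_pos:
  assumes "c \<in> N" and "x \<in> cod c"
  shows "det (gram (su3_metric \<omega> \<Omega> c x)) > 0"
  using inner_form.exists_orthonormal inner_form.det_gram_pos SU3_inner_form[OF assms] by blast

lemma continuous_on_covector_norm2:
  assumes c: "c \<in> N" and \<alpha>: "smooth_form N k \<alpha>"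
  shows "continuous_on (cod c) (\<lambda>x. covector_norm2 k (su3_metric \<omega> \<Omega> c x) (\<alpha> c x))"
proof -
  have "continuous_on (cod c) (\<lambda>x. \<alpha> c x v)" for v
    using \<alpha> c by (auto simp: smooth_form_def intro!: smooth_on_continuous)
  moreover have "det (gram (su3_metric \<omega> \<Omega> c x)) \<noteq> 0" if "x \<in> cod c" for x
    using det_gram_pos[OF c that] by simp
  ultimately show ?thesis
    unfolding covector_norm2_def
    by (intro continuous_intros continuous_on_matrix_inv continuous_on_gram c) auto
qed

context
  assumes N: "smooth_manifold N"
begin

lemma su3_metric_transition:
  assumes c: "c \<in> N" and c': "c' \<in> N" and p: "p \<in> fst c" "p \<in> fst c'"
  defines "D \<equiv> frechet_derivative (transition c c') (at (snd c p))"
  shows "su3_metric \<omega> \<Omega> c' (snd c' p) (D u) (D v) = su3_metric \<omega> \<Omega> c (snd c p) u v"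
proof -
  have x: "snd c p \<in> snd c ` (fst c \<inter> fst c')"
    using p by blast
  have \<omega>: "smooth_form N 2 \<omega>" and \<Omega>: "smooth_form N 3 \<Omega>"
    using SU3 by (simp_all add: SU3_structure_def complex_volume_form_def)
  have J: "acs \<Omega> c' (snd c' p) (D v) = D (acs \<Omega> c (snd c p) v)" for v
    using smooth_form_transition[OF N \<Omega> c c' p] linear_transition[OF N c c' x] unfolding D_def
    by (intro acs_pullback[OF SU3_complex_3_covector[OF c snd_in[OF p(1)]]
          SU3_complex_3_covector[OF c' snd_in[OF p(2)]]])
  show ?thesis
    unfolding su3_metric_def J
    using smooth_form_transition[OF N \<omega> c c' p, of "vec2 u (acs \<Omega> c (snd c p) v)"]
    by (simp add: vec2_comp D_def)
qed

text \<open>\<open>form_norm2\<close> evaluates in whichever chart \<open>chart_at\<close> picks at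
  each point, with no regularity in \<open>p\<close>. Transition maps are isometries compatible with
  the form, so any fixed chart gives the same value on its domain.\<close>

lemma form_norm2_chart:
  assumes c: "c \<in> N" and p: "p \<in> fst c" and \<alpha>: "smooth_form N k \<alpha>"
  shows "form_norm2 N (su3_metric \<omega> \<Omega>) k \<alpha> p
    = covector_norm2 k (su3_metric \<omega> \<Omega> c (snd c p)) (\<alpha> c (snd c p))"
proof -
  define c' where "c' = chart_at N p"
  have c': "c' \<in> N" "p \<in> fst c'"
    using chart_at[OF N, of p] by (auto simp: c'_def)
  have alt: "alternating k (\<alpha> c (snd c p))" if "c \<in> N" "p \<in> fst c" for c
    using \<alpha> that snd_in[OF that(2)] by (simp add: smooth_form_def)
  have "covector_norm2 k (su3_metric \<omega> \<Omega> c' (snd c' p)) (\<alpha> c' (snd c' p))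
      = covector_norm2 k (su3_metric \<omega> \<Omega> c (snd c p)) (\<alpha> c (snd c p))"
    by (rule covector_norm2_pullback[OF SU3_inner_form[OF c'(1) snd_in[OF c'(2)]]
          SU3_inner_form[OF c snd_in[OF p]] su3_metric_transition[OF c'(1) c c'(2) p]
          alt[OF c'] alt[OF c p] smooth_form_transition[OF N \<alpha> c'(1) c c'(2) p]])
  then show ?thesis
    by (simp add: form_norm2_def c'_def Let_def)
qed

lemma continuous_on_form_norm2:
  assumes \<alpha>: "smooth_form N k \<alpha>"
  shows "continuous_on UNIV (form_norm2 N (su3_metric \<omega> \<Omega>) k \<alpha>)"
proof -
  have "continuous_on (\<Union>c\<in>N. fst c) (form_norm2 N (su3_metric \<omega> \<Omega>) k \<alpha>)"
  proof (rule continuous_on_open_UN)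
    fix c assume c: "c \<in> N"
    then show "open (fst c)"
      using N by (simp add: smooth_manifold_def)
    have "continuous_on (fst c) (snd c)"
      using N c by (simp add: smooth_manifold_def homeomorphism_def)
    then have "continuous_on (fst c)
        (\<lambda>p. covector_norm2 k (su3_metric \<omega> \<Omega> c (snd c p)) (\<alpha> c (snd c p)))"
      by (rule continuous_on_compose2[OF continuous_on_covector_norm2[OF c \<alpha>]])
        (simp add: cod_def)
    then show "continuous_on (fst c) (form_norm2 N (su3_metric \<omega> \<Omega>) k \<alpha>)"
      by (simp add: form_norm2_chart[OF c _ \<alpha>] cong: continuous_on_cong)
  qed
  then show ?thesis
    using N by (simp add: smooth_manifold_def)
qed

lemma form_norm2_nonneg:
  assumes \<alpha>: "smooth_form N k \<alpha>"
  shows "form_norm2 N (su3_metric \<omega> \<Omega>) k \<alpha> p \<ge> 0"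
proof -
  have c: "chart_at N p \<in> N" and x: "snd (chart_at N p) p \<in> cod (chart_at N p)"
    using chart_at[OF N, of p] snd_in[of p "chart_at N p"] by simp_all
  then have "alternating k (\<alpha> (chart_at N p) (snd (chart_at N p) p))"
    using \<alpha> by (simp add: smooth_form_def)
  then show ?thesis
    unfolding form_norm2_def Let_def
    by (rule inner_form.covector_norm2_nonneg[OF SU3_inner_form[OF c x]])
qed

lemma form_norm2_eq_0:
  assumes \<alpha>: "smooth_form N k \<alpha>" and zero: "\<And>p. form_norm2 N (su3_metric \<omega> \<Omega>) k \<alpha> p = 0"
  shows "form_eq N \<alpha> form_zero"
  unfolding form_eq_def form_zero_def
proof (intro ballI allI)
  fix c x v assume c: "c \<in> N" and x: "x \<in> cod c"
  have "covector_norm2 k (su3_metric \<omega> \<Omega> c x) (\<alpha> c x) = 0"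
    using form_norm2_chart[OF c _ \<alpha>, of "pt c x"] zero pt_in[OF N c x] by simp
  moreover have "alternating k (\<alpha> c x)"
    using \<alpha> c x by (simp add: smooth_form_def)
  ultimately show "\<alpha> c x v = 0"
    using inner_form.covector_norm2_eq_0 SU3_inner_form[OF c x] by blast
qed

end

end

section \<open>The functional\<close>

context
  fixes N :: "('n::{t2_space,second_countable_topology}, real^6) chart set"
    and \<omega> :: "('n, real^6, real) form" and \<Omega> :: "('n, real^6, complex) form"
    and vol :: "'n measure"
  assumes SU3: "SU3_structure N \<omega> \<Omega>" and N: "smooth_manifold N"
    and vol: "riemannian_volume N (su3_metric \<omega> \<Omega>) vol"
begin

lemma sets_vol: "sets vol = sets borel"
  using vol by (simp add: riemannian_volume_def)

lemma space_vol: "space vol = UNIV"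
  using sets_eq_imp_space_eq[OF sets_vol] by simp

definition density :: "('n, real^6) chart \<Rightarrow> real^6 \<Rightarrow> real" where
  "density c x = sqrt (det (gram (su3_metric \<omega> \<Omega> c x)))"

lemma emeasure_vol:
  assumes "c \<in> N" and "open B" and "B \<subseteq> fst c"
  shows "emeasure vol B
    = (\<integral>\<^sup>+x. ennreal (density c x) * indicator (snd c ` B) x \<partial>lborel)"
  using vol assms by (simp add: riemannian_volume_def density_def)

lemma continuous_on_density: "c \<in> N \<Longrightarrow> continuous_on (cod c) (density c)"
  unfolding density_def
  by (intro continuous_on_real_sqrt continuous_on_det continuous_on_gram[OF SU3])

text \<open>The density is continuous and positive on a compact ball, so it lies between two
  constants. The lower bound \<open>m\<close> serves positivity of \<open>vol\<close> on open sets,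
  the upper bound \<open>K\<close> its finiteness.\<close>

lemma coordinate_ball:
  assumes U: "open U" "p \<in> U"
  obtains c V y r m K where "c \<in> N" "open V" "p \<in> V" "V \<subseteq> U" "V \<subseteq> fst c" "0 < r" "0 < m"
    "snd c ` V = ball y r" "\<And>x. x \<in> ball y r \<Longrightarrow> m \<le> density c x \<and> density c x \<le> K"
proof -
  obtain c where c: "c \<in> N" "p \<in> fst c"
    using chart_at[OF N] by blast
  have hom: "homeomorphism (fst c) (cod c) (snd c) (pt c)"
    and op: "open (fst c)" "open (cod c)"
    using N c by (auto simp: smooth_manifold_def)
  define y where "y = snd c p"
  have y: "pt c y \<in> U" "y \<in> cod c"
    using U pt_snd[OF N c] c by (auto simp: y_def cod_def)
  have "open (cod c \<inter> pt c -` U)"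
    using hom op U by (intro continuous_open_preimage) (auto simp: homeomorphism_def)
  then obtain r where r: "0 < r" "cball y r \<subseteq> cod c \<inter> pt c -` U"
    using y by (metis IntI open_contains_cball vimageI)
  have cont: "continuous_on (cball y r) (density c)"
    using continuous_on_density[OF c(1)] r by (auto intro: continuous_on_subset)
  have ne: "cball y r \<noteq> {}"
    using r by simp
  obtain x0 where x0: "x0 \<in> cball y r" "\<And>x. x \<in> cball y r \<Longrightarrow> density c x0 \<le> density c x"
    using continuous_attains_inf[OF compact_cball ne cont] by blast
  obtain x1 where x1: "\<And>x. x \<in> cball y r \<Longrightarrow> density c x \<le> density c x1"
    using continuous_attains_sup[OF compact_cball ne cont] by blast
  define V where "V = fst c \<inter> snd c -` ball y r"
  show ?thesis
  proof (rule that[of c V r "density c x0" y "density c x1"])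
    show "open V"
      unfolding V_def using hom op
      by (intro continuous_open_preimage) (auto simp: homeomorphism_def)
    show "p \<in> V" "V \<subseteq> fst c"
      using c r by (auto simp: V_def y_def)
    show "V \<subseteq> U"
    proof
      fix q assume "q \<in> V"
      then have "q \<in> fst c" and "snd c q \<in> cball y r"
        by (auto simp: V_def)
      then show "q \<in> U"
        using r(2) pt_snd[OF N c(1), of q] by auto
    qed
    show "0 < density c x0"
      using det_gram_pos[OF SU3 c(1), of x0] r x0 by (auto simp: density_def)
    have "x \<in> snd c ` V" if "x \<in> ball y r" for x
      using pt_in[OF N c(1), of x] r that by (force simp: V_def)
    then show "snd c ` V = ball y r"
      by (auto simp: V_def)
    show "density c x0 \<le> density c x \<and> density c x \<le> density c x1" if "x \<in> ball y r" for x
      using x0 x1 that by simp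
  qed (use c r in auto)
qed

lemma emeasure_vol_open_pos:
  assumes "open U" and "p \<in> U"
  shows "emeasure vol U > 0"
proof -
  obtain c V y r m K where V: "c \<in> N" "open V" "p \<in> V" "V \<subseteq> U" "V \<subseteq> fst c" "0 < r" "0 < m"
    "snd c ` V = ball y r" and m: "\<And>x. x \<in> ball y r \<Longrightarrow> m \<le> density c x \<and> density c x \<le> K"
    using coordinate_ball[OF assms] by metis
  have "0 < measure lborel (ball y r)"
    using V content_ball_pos by blast
  then have "0 < emeasure lborel (ball y r)"
    by (metis emeasure_eq_ennreal_measure ennreal_less_zero_iff ennreal_zero_less_top measure_def enn2real_positive_iff)
  then have "0 < ennreal m * emeasure lborel (ball y r)"
    using V by (simp add: ennreal_zero_less_mult_iff)
  also have "\<dots> = (\<integral>\<^sup>+x. ennreal m * indicator (ball y r) x \<partial>lborel)"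
    by (rule nn_integral_cmult_indicator[symmetric]) simp
  also have "\<dots> \<le> (\<integral>\<^sup>+x. ennreal (density c x) * indicator (snd c ` V) x \<partial>lborel)"
    unfolding V using m by (intro nn_integral_mono) (auto simp: indicator_def intro: ennreal_leI)
  also have "\<dots> = emeasure vol V"
    using V by (simp add: emeasure_vol)
  also have "\<dots> \<le> emeasure vol U"
    using V assms by (intro emeasure_mono) (auto simp: sets_vol)
  finally show ?thesis .
qed

lemma finite_measure_vol:
  assumes cpt: "compact (UNIV :: 'n set)"
  shows "finite_measure vol"
proof -
  let ?C = "{V. open V \<and> emeasure vol V < \<infinity>}"
  have "\<exists>V\<in>?C. p \<in> V" for p
  proof -
    obtain c V y r m K where V: "c \<in> N" "open V" "p \<in> V" "V \<subseteq> fst c"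
      "snd c ` V = ball y r" and K: "\<And>x. x \<in> ball y r \<Longrightarrow> m \<le> density c x \<and> density c x \<le> K"
      using coordinate_ball[of UNIV p] by (metis UNIV_I open_UNIV)
    have "emeasure vol V = (\<integral>\<^sup>+x. ennreal (density c x) * indicator (snd c ` V) x \<partial>lborel)"
      using V by (simp add: emeasure_vol)
    also have "\<dots> \<le> (\<integral>\<^sup>+x. ennreal K * indicator (ball y r) x \<partial>lborel)"
      unfolding V using K by (intro nn_integral_mono) (auto simp: indicator_def intro: ennreal_leI)
    also have "\<dots> = ennreal K * emeasure lborel (ball y r)"
      by (rule nn_integral_cmult_indicator) simp
    also have "\<dots> < \<infinity>"
      using emeasure_lborel_ball_finite[of y r] by (simp add: ennreal_mult_less_top)
    finally show ?thesis
      using V by blast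
  qed
  then have "UNIV \<subseteq> \<Union>?C"
    by blast
  then obtain D where D: "D \<subseteq> ?C" "finite D" "UNIV \<subseteq> \<Union>D"
    by (rule compactE[OF cpt]) auto
  have "emeasure vol (\<Union>V\<in>D. V) \<le> (\<Sum>V\<in>D. emeasure vol V)"
    using D by (intro emeasure_subadditive_finite) (auto simp: sets_vol)
  also have "\<dots> < \<infinity>"
    using D by (auto simp: less_top[symmetric] subset_eq)
  finally show ?thesis
    using D by (intro finite_measureI) (auto simp: space_vol top.extremum_unique)
qed

lemma continuous_nonneg_integral_0:
  fixes q :: "'n \<Rightarrow> real"
  assumes cpt: "compact (UNIV :: 'n set)" and q: "continuous_on UNIV q" "\<And>p. q p \<ge> 0"
    and zero: "(\<integral>p. q p \<partial>vol) = 0"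
  shows "q p = 0"
proof (rule ccontr)
  assume "q p \<noteq> 0"
  interpret finite_measure vol
    by (rule finite_measure_vol[OF cpt])
  have meas: "q \<in> borel_measurable vol"
    using borel_measurable_continuous_onI[OF q(1)] measurable_cong_sets[OF sets_vol refl] by blast
  \<comment> \<open>Compactness bounds \<open>q\<close>, so \<open>q\<close> is integrable for the
    finite measure; only then does the zero integral force \<open>q\<close> to vanish almost
    everywhere.\<close>
  obtain K where "\<And>p. norm (q p) \<le> K"
    using compact_imp_bounded[OF compact_continuous_image[OF q(1) cpt]] by (auto simp: bounded_iff)
  then have "integrable vol q"
    using meas by (intro integrable_const_bound[of _ K]) auto
  then have "AE p in vol. q p = 0"
    using integral_nonneg_eq_0_iff_AE[of vol q] q zero by simp
  moreover have op: "open {p. q p \<noteq> 0}"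
    using open_Collect_neq[OF q(1)] by (simp add: continuous_on_const)
  ultimately have "emeasure vol {p. q p \<noteq> 0} = 0"
    using AE_iff_measurable[of "{p. q p \<noteq> 0}" vol "\<lambda>p. q p = 0"]
    by (simp add: sets_vol space_vol)
  then show False
    using emeasure_vol_open_pos[OF op, of p] \<open>q p \<noteq> 0\<close> by simp
qed

definition integrand :: "('n \<Rightarrow> real) \<Rightarrow> ('n, real^6, real) form \<Rightarrow>
    ('n, real^6, real) form \<Rightarrow> ('n, real^6, real) form \<Rightarrow> 'n \<Rightarrow> real" where
  "integrand l \<theta> \<nu> F p = 15/8 * (l p)\<^sup>2 + 5/18 * form_norm2 N (su3_metric \<omega> \<Omega>) 1 \<theta> p
     + 1/4 * form_norm2 N (su3_metric \<omega> \<Omega>) 3 \<nu> p + 1/4 * form_norm2 N (su3_metric \<omega> \<Omega>) 2 F p"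

lemma reduced_functional_integrand:
  "reduced_functional N vol \<omega> \<Omega> l \<theta> \<nu> F = - 2 * pi * (\<integral>p. integrand l \<theta> \<nu> F p \<partial>vol)"
  by (simp add: reduced_functional_def integrand_def Let_def)

lemma integrand_eq_0:
  assumes "reduced_variables N \<omega> \<Omega> l \<theta> \<nu> F" and zero: "\<And>p. integrand l \<theta> \<nu> F p = 0"
  shows "all_zero N l \<theta> \<nu> F"
proof -
  have smooth: "smooth_form N 1 \<theta>" "smooth_form N 3 \<nu>" "smooth_form N 2 F"
    using assms(1) by (simp_all add: reduced_variables_def)
  note nonneg = smooth[THEN form_norm2_nonneg[OF SU3 N]]
  have "l p = 0 \<and> form_norm2 N (su3_metric \<omega> \<Omega>) 1 \<theta> p = 0
      \<and> form_norm2 N (su3_metric \<omega> \<Omega>) 3 \<nu> p = 0 \<and> form_norm2 N (su3_metric \<omega> \<Omega>) 2 F p = 0" for p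
  proof -
    have "(l p)\<^sup>2 = 0 \<and> form_norm2 N (su3_metric \<omega> \<Omega>) 1 \<theta> p = 0
      \<and> form_norm2 N (su3_metric \<omega> \<Omega>) 3 \<nu> p = 0 \<and> form_norm2 N (su3_metric \<omega> \<Omega>) 2 F p = 0"
      using zero[of p] nonneg[of p] zero_le_power2[of "l p"] unfolding integrand_def by linarith
    then show ?thesis
      by simp
  qed
  then show ?thesis
    using smooth[THEN form_norm2_eq_0[OF SU3 N]] by (simp add: all_zero_def)
qed

lemma form_norm2_scale:
  assumes "\<And>c x v. c \<in> N \<Longrightarrow> x \<in> cod c \<Longrightarrow> \<alpha> c x v = r * \<beta> c x v"
  shows "form_norm2 N g k \<alpha> p = r\<^sup>2 * form_norm2 N g k \<beta> p"
  using chart_at[OF N, of p] snd_in[of p "chart_at N p"]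
  by (simp add: form_norm2_def covector_norm2_def Let_def assms sum_distrib_left
      power2_eq_square mult_ac)

text \<open>For the direction from right to left: along a line through zero the functional is
  \<open>t\<^sup>2\<close> times its value at the variation, so its derivative at 0
  vanishes.\<close>

lemma formal_critical_point_iff:
  assumes cpt: "compact (UNIV :: 'n set)" and var: "reduced_variables N \<omega> \<Omega> l \<theta> \<nu> F"
  shows "formal_critical_point N vol \<omega> \<Omega> l \<theta> \<nu> F \<longleftrightarrow> all_zero N l \<theta> \<nu> F"
proof
  let ?I = "\<integral>p. integrand l \<theta> \<nu> F p \<partial>vol"
  assume "formal_critical_point N vol \<omega> \<Omega> l \<theta> \<nu> F"
  then have "((\<lambda>t. reduced_functional N vol \<omega> \<Omega> (\<lambda>p. l p + t * l p)
      (form_add \<theta> (form_scale t \<theta>)) (form_add \<nu> (form_scale t \<nu>)) (form_add F (form_scale t F)))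
      has_real_derivative 0) (at 0)"
    using var by (simp add: formal_critical_point_def)
  moreover have "reduced_functional N vol \<omega> \<Omega> (\<lambda>p. l p + t * l p)
      (form_add \<theta> (form_scale t \<theta>)) (form_add \<nu> (form_scale t \<nu>)) (form_add F (form_scale t F))
      = - 2 * pi * ((1 + t)\<^sup>2 * ?I)" for t
  proof -
    have norm: "form_norm2 N (su3_metric \<omega> \<Omega>) k (form_add \<alpha> (form_scale t \<alpha>)) p
        = (1 + t)\<^sup>2 * form_norm2 N (su3_metric \<omega> \<Omega>) k \<alpha> p" for k \<alpha> p
      by (rule form_norm2_scale) (simp add: form_add_def form_scale_def algebra_simps)
    have "(l p + t * l p)\<^sup>2 = (1 + t)\<^sup>2 * (l p)\<^sup>2" for p
      by (simp add: power2_eq_square algebra_simps)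
    then have "integrand (\<lambda>p. l p + t * l p) (form_add \<theta> (form_scale t \<theta>))
        (form_add \<nu> (form_scale t \<nu>)) (form_add F (form_scale t F)) p
        = (1 + t)\<^sup>2 * integrand l \<theta> \<nu> F p" for p
      unfolding integrand_def norm by (simp add: distrib_left)
    then show ?thesis
      by (simp add: reduced_functional_integrand)
  qed
  ultimately have "((\<lambda>t. - 2 * pi * ((1 + t)\<^sup>2 * ?I)) has_real_derivative 0) (at 0)"
    by simp
  moreover have "((\<lambda>t. - 2 * pi * ((1 + t)\<^sup>2 * ?I)) has_real_derivative - 4 * pi * ?I) (at 0)"
    by (auto intro!: derivative_eq_intros)
  ultimately have "?I = 0"
    using DERIV_unique by fastforce
  have smooth: "smooth_form N 1 \<theta>" "smooth_form N 3 \<nu>" "smooth_form N 2 F"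
    and l: "continuous_on UNIV l"
    using var by (simp_all add: reduced_variables_def smooth_map_def)
  note nonneg = smooth[THEN form_norm2_nonneg[OF SU3 N]]
  have "continuous_on UNIV (integrand l \<theta> \<nu> F)"
    unfolding integrand_def
    by (intro continuous_intros l smooth[THEN continuous_on_form_norm2[OF SU3 N]])
  moreover have "integrand l \<theta> \<nu> F p \<ge> 0" for p
    unfolding integrand_def by (intro add_nonneg_nonneg mult_nonneg_nonneg nonneg) auto
  ultimately show "all_zero N l \<theta> \<nu> F"
    using continuous_nonneg_integral_0[OF cpt _ _ \<open>?I = 0\<close>] by (intro integrand_eq_0[OF var]) blast
next
  assume zero: "all_zero N l \<theta> \<nu> F"
  show "formal_critical_point N vol \<omega> \<Omega> l \<theta> \<nu> F"
    unfolding formal_critical_point_def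
  proof (intro allI impI)
    fix l' \<theta>' \<nu>' F'
    let ?I = "\<integral>p. integrand l' \<theta>' \<nu>' F' p \<partial>vol"
    have "reduced_functional N vol \<omega> \<Omega> (\<lambda>p. l p + t * l' p)
      (form_add \<theta> (form_scale t \<theta>')) (form_add \<nu> (form_scale t \<nu>')) (form_add F (form_scale t F'))
      = - 2 * pi * (t\<^sup>2 * ?I)" for t
    proof -
      have norm: "form_norm2 N (su3_metric \<omega> \<Omega>) k (form_add \<alpha> (form_scale t \<beta>)) p
          = t\<^sup>2 * form_norm2 N (su3_metric \<omega> \<Omega>) k \<beta> p" if "form_eq N \<alpha> form_zero" for k \<alpha> \<beta> p
        using that
        by (intro form_norm2_scale) (simp add: form_add_def form_scale_def form_eq_def form_zero_def)
      have "integrand (\<lambda>p. l p + t * l' p) (form_add \<theta> (form_scale t \<theta>'))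
          (form_add \<nu> (form_scale t \<nu>')) (form_add F (form_scale t F')) p
          = t\<^sup>2 * integrand l' \<theta>' \<nu>' F' p" for p
        using zero
        by (simp add: all_zero_def integrand_def norm power_mult_distrib distrib_left)
      then show ?thesis
        by (simp add: reduced_functional_integrand)
    qed
    then show "((\<lambda>t. reduced_functional N vol \<omega> \<Omega> (\<lambda>p. l p + t * l' p)
      (form_add \<theta> (form_scale t \<theta>')) (form_add \<nu> (form_scale t \<nu>')) (form_add F (form_scale t F')))
      has_real_derivative 0) (at 0)"
      by (auto intro!: derivative_eq_intros)
  qed
qed

end

section \<open>From the total space to the base, and the structure equations\<close>

lemma pullback_eq_0:
  assumes M: "smooth_manifold M" and N: "smooth_manifold N"
    and proj: "quotient_projection M act N proj"
    and zero: "form_eq M (pullback N proj \<alpha>) form_zero"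
  shows "\<alpha> (chart_at N p) (snd (chart_at N p) p) w = 0"
proof -
  define c' where "c' = chart_at N p"
  have c': "c' \<in> N" "p \<in> fst c'"
    using chart_at[OF N, of p] by (simp_all add: c'_def)
  obtain q where q: "proj q = p"
    using proj unfolding quotient_projection_def by (metis surjD)
  define c where "c = chart_at M q"
  have c: "c \<in> M" "q \<in> fst c"
    using chart_at[OF M, of q] by (simp_all add: c_def)
  define D where "D = frechet_derivative (snd c' \<circ> proj \<circ> pt c) (at (snd c q))"
  have "snd c q \<in> snd c ` (fst c \<inter> proj -` fst c')"
    using c c' q by auto
  moreover have "\<forall>c\<in>M. \<forall>c'\<in>N. \<forall>x\<in>snd c ` (fst c \<inter> proj -` fst c').
      surj (frechet_derivative (snd c' \<circ> proj \<circ> pt c) (at x))"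
    using proj unfolding quotient_projection_def by simp
  ultimately have "surj D"
    unfolding D_def using c(1) c'(1) by blast
  \<comment> \<open>As \<open>proj\<close> is a submersion, every sequence of vectors on the base
    lifts through \<open>D\<close>. Since \<open>pullback\<close> evaluates in
    \<open>chart_at N p\<close>, the conclusion is obtained in that chart only.\<close>
  then have v: "D (inv D (w i)) = w i" for i
    by (rule surj_f_inv_f)
  have "pullback N proj \<alpha> c (snd c q) (\<lambda>i. inv D (w i)) = 0"
    using zero c snd_in[OF c(2)] by (simp add: form_eq_def form_zero_def)
  then show ?thesis
    using q v pt_snd[OF M c] by (simp add: pullback_def Let_def c'_def D_def)
qed

lemma pullback_zero:
  assumes N: "smooth_manifold N" and "form_eq N \<alpha> form_zero"
  shows "form_eq M (pullback N proj \<alpha>) form_zero"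
  unfolding form_eq_def form_zero_def
proof (intro ballI allI)
  fix c x v
  have "snd (chart_at N q) q \<in> cod (chart_at N q)" "chart_at N q \<in> N" for q
    using chart_at[OF N, of q] snd_in[of q "chart_at N q"] by simp_all
  then show "pullback N proj \<alpha> c x v = 0"
    using assms(2) by (simp add: pullback_def Let_def form_eq_def form_zero_def)
qed

lemma wedge_zero_left: "wedge k l (\<lambda>v. 0) b = (\<lambda>v. 0)"
  by (simp add: wedge_def fun_eq_iff)

lemma wedge_scale_left: "wedge k l (\<lambda>v. r * a v) b v = r * wedge k l a b v"
  by (simp add: wedge_def sum_distrib_left mult_ac)

lemma all_zero_iff:
  assumes M: "smooth_manifold M" and N: "smooth_manifold N"
    and proj: "quotient_projection M act N proj"
    and SU3: "SU3_structure N \<omega> \<Omega>"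
    and var: "reduced_variables N \<omega> \<Omega> l \<theta> \<nu> F"
    and d\<Omega>: "form_eq N (ext_d 3 \<Omega>) (form_wedge 1 3 (form_complex \<theta>) \<Omega>)"
    and d\<omega>: "form_eq N (ext_d 2 \<omega>) (form_add (form_scale (2/3) (form_wedge 1 2 \<theta> \<omega>)) \<nu>)"
    and d\<eta>: "form_eq M (ext_d 1 \<eta>) (pullback N proj (form_add F (fun_scale l \<omega>)))"
  shows "all_zero N l \<theta> \<nu> F \<longleftrightarrow>
    form_eq M (ext_d 1 \<eta>) form_zero \<and> form_eq N (ext_d 2 \<omega>) form_zero
      \<and> form_eq N (ext_d 3 \<Omega>) form_zero"
proof
  assume zero: "all_zero N l \<theta> \<nu> F"
  have \<theta>: "\<theta> c x = (\<lambda>v. 0)" if "c \<in> N" "x \<in> cod c" for c x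
    using zero that by (auto simp: all_zero_def form_eq_def form_zero_def)
  have "form_eq N (form_add F (fun_scale l \<omega>)) form_zero"
    using zero by (simp add: all_zero_def form_eq_def form_zero_def form_add_def fun_scale_def)
  then have "form_eq M (pullback N proj (form_add F (fun_scale l \<omega>))) form_zero"
    by (rule pullback_zero[OF N])
  then have "form_eq M (ext_d 1 \<eta>) form_zero"
    using d\<eta> by (simp add: form_eq_def)
  moreover have "form_eq N (ext_d 2 \<omega>) form_zero"
    using d\<omega> zero
    by (simp add: all_zero_def form_eq_def form_zero_def form_add_def form_scale_def
        form_wedge_def \<theta> wedge_zero_left)
  moreover have "form_eq N (ext_d 3 \<Omega>) form_zero"
    using d\<Omega>
    by (simp add: form_eq_def form_zero_def form_wedge_def form_complex_def \<theta> wedge_zero_left)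
  ultimately show "form_eq M (ext_d 1 \<eta>) form_zero \<and> form_eq N (ext_d 2 \<omega>) form_zero
      \<and> form_eq N (ext_d 3 \<Omega>) form_zero"
    by blast
next
  assume zero: "form_eq M (ext_d 1 \<eta>) form_zero \<and> form_eq N (ext_d 2 \<omega>) form_zero
      \<and> form_eq N (ext_d 3 \<Omega>) form_zero"
  have \<theta>: "\<theta> c x v = 0" if c: "c \<in> N" and x: "x \<in> cod c" for c x v
  proof (rule complex_3_covector.wedge_1_3_eq_0[OF SU3_complex_3_covector[OF SU3 c x]])
    show "alternating 1 (\<theta> c x)"
      using var c x by (simp add: reduced_variables_def smooth_form_def)
    show "wedge 1 3 (\<lambda>v. complex_of_real (\<theta> c x v)) (\<Omega> c x) v = 0" for v
      using d\<Omega> zero c x by (simp add: form_eq_def form_zero_def form_wedge_def form_complex_def)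
  qed
  have "\<nu> c x v = 0" if c: "c \<in> N" and x: "x \<in> cod c" for c x v
  proof -
    have "\<theta> c x = (\<lambda>v. 0)"
      using \<theta>[OF c x] by blast
    moreover have "ext_d 2 \<omega> c x v = 2 / 3 * wedge 1 2 (\<theta> c x) (\<omega> c x) v + \<nu> c x v"
      using d\<omega> c x by (simp add: form_eq_def form_add_def form_scale_def form_wedge_def)
    moreover have "ext_d 2 \<omega> c x v = 0"
      using zero c x by (simp add: form_eq_def form_zero_def)
    ultimately show ?thesis
      by (simp add: wedge_zero_left)
  qed
  moreover have l: "l p = 0" and F: "F (chart_at N p) (snd (chart_at N p) p) w = 0" for p w
  proof -
    define c where "c = chart_at N p"
    define x where "x = snd c p"
    have c: "c \<in> N" "p \<in> fst c"
      using chart_at[OF N, of p] by (simp_all add: c_def)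
    have x: "x \<in> cod c"
      unfolding x_def by (rule snd_in[OF c(2)])
    have "form_eq M (pullback N proj (form_add F (fun_scale l \<omega>))) form_zero"
      using d\<eta> zero by (simp add: form_eq_def)
    then have "F c x w + l p * \<omega> c x w = 0" for w
      using pullback_eq_0[OF M N proj, of "form_add F (fun_scale l \<omega>)" p w] pt_snd[OF N c]
      by (simp add: form_add_def fun_scale_def c_def x_def)
    then have F: "F c x w = (- l p) * \<omega> c x w" for w
      by (simp add: eq_neg_iff_add_eq_0)
    obtain v where v: "wedge 2 4 (\<omega> c x) (wedge 2 2 (\<omega> c x) (\<omega> c x)) v \<noteq> 0"
      using SU3_cube_neq_0[OF SU3 c(1) x] by blast
    \<comment> \<open>This is the primitivity of \<open>F\<close> contained in
      \<open>reduced_variables\<close>.\<close>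
    have "wedge 2 4 (F c x) (wedge 2 2 (\<omega> c x) (\<omega> c x)) v = 0"
      using var c x by (simp add: reduced_variables_def form_eq_def form_zero_def form_wedge_def)
    moreover have "F c x = (\<lambda>w. (- l p) * \<omega> c x w)"
      using F by blast
    ultimately show l: "l p = 0"
      using v wedge_scale_left[of 2 4 "- l p" "\<omega> c x"] by simp
    show "F (chart_at N p) (snd (chart_at N p) p) w = 0"
      using F[of w] l by (simp add: c_def x_def)
  qed
  \<comment> \<open>So far \<open>F\<close> vanishes only in the charts picked by
    \<open>chart_at\<close>; the transformation rule carries this to every chart.\<close>
  moreover have "F c x v = 0" if c: "c \<in> N" and x: "x \<in> cod c" for c x v
  proof -
    have sF: "smooth_form N 2 F"
      using var by (simp add: reduced_variables_def)
    have p: "pt c x \<in> fst c" "snd c (pt c x) = x"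
      using pt_in[OF N c x] by simp_all
    show ?thesis
      using smooth_form_transition[OF N sF c _ p(1), of "chart_at N (pt c x)" v]
        chart_at[OF N, of "pt c x"] F[of "pt c x"] p(2) by simp
  qed
  ultimately show "all_zero N l \<theta> \<nu> F"
    using \<theta> by (simp add: all_zero_def form_eq_def form_zero_def)
qed

theorem corollary1:
  fixes M :: "('m::{t2_space,second_countable_topology}, real^7) chart set"
    and N :: "('n::{t2_space,second_countable_topology}, real^6) chart set"
    and act :: "complex \<Rightarrow> 'm \<Rightarrow> 'm"
    and proj :: "'m \<Rightarrow> 'n"
    and \<eta> \<phi> :: "('m, real^7, real) form"
    and \<omega> \<theta> \<nu>\<^sub>3 F\<^sub>0 :: "('n, real^6, real) form"
    and \<Omega> :: "('n, real^6, complex) form"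
    and l :: "'n \<Rightarrow> real"
    and vol :: "'n measure"
  assumes "smooth_manifold M" and "smooth_manifold N" and "compact (UNIV :: 'n set)"
    and "free_circle_action M act" and "quotient_projection M act N proj"
    and "SU3_structure N \<omega> \<Omega>" and "connection_form M act \<eta>"
    and "reduced_variables N \<omega> \<Omega> l \<theta> \<nu>\<^sub>3 F\<^sub>0"
    and "form_eq M \<phi> (form_add (form_wedge 1 2 \<eta> (pullback N proj \<omega>))
                              (pullback N proj (form_Re \<Omega>)))"
    and "G2_structure M \<phi>" and "circle_invariant M act \<phi>"
    and "\<forall>c\<in>M. \<forall>x\<in>cod c. G2_metric (\<phi> c x) (generator act c x) (generator act c x) = 1"
    and "form_eq N (ext_d 3 \<Omega>) (form_wedge 1 3 (form_complex \<theta>) \<Omega>)"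
    and "form_eq N (ext_d 2 \<omega>) (form_add (form_scale (2/3) (form_wedge 1 2 \<theta> \<omega>)) \<nu>\<^sub>3)"
    and "form_eq M (ext_d 1 \<eta>) (pullback N proj (form_add F\<^sub>0 (fun_scale l \<omega>)))"
    and "riemannian_volume N (su3_metric \<omega> \<Omega>) vol"
  shows "(\<forall>l' \<theta>' \<nu>' F'. reduced_variables N \<omega> \<Omega> l' \<theta>' \<nu>' F' \<longrightarrow>
           (formal_critical_point N vol \<omega> \<Omega> l' \<theta>' \<nu>' F' \<longleftrightarrow> all_zero N l' \<theta>' \<nu>' F'))
    \<and> (all_zero N l \<theta> \<nu>\<^sub>3 F\<^sub>0 \<longleftrightarrow>
           form_eq M (ext_d 1 \<eta>) form_zero \<and> form_eq N (ext_d 2 \<omega>) form_zero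
             \<and> form_eq N (ext_d 3 \<Omega>) form_zero)
    \<and> (formal_critical_point N vol \<omega> \<Omega> l \<theta> \<nu>\<^sub>3 F\<^sub>0 \<longleftrightarrow>
           flat_connection M \<eta> \<and> Calabi_Yau N \<omega> \<Omega>)"
proof (intro conjI)
  show "\<forall>l' \<theta>' \<nu>' F'. reduced_variables N \<omega> \<Omega> l' \<theta>' \<nu>' F' \<longrightarrow>
      (formal_critical_point N vol \<omega> \<Omega> l' \<theta>' \<nu>' F' \<longleftrightarrow> all_zero N l' \<theta>' \<nu>' F')"
    using formal_critical_point_iff[OF assms(6,2,16,3)] by blast
  show zero: "all_zero N l \<theta> \<nu>\<^sub>3 F\<^sub>0 \<longleftrightarrow> form_eq M (ext_d 1 \<eta>) form_zero
      \<and> form_eq N (ext_d 2 \<omega>) form_zero \<and> form_eq N (ext_d 3 \<Omega>) form_zero"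
    by (rule all_zero_iff[OF assms(1,2,5,6,8,13,14,15)])
  show "formal_critical_point N vol \<omega> \<Omega> l \<theta> \<nu>\<^sub>3 F\<^sub>0
      \<longleftrightarrow> flat_connection M \<eta> \<and> Calabi_Yau N \<omega> \<Omega>"
    \<comment> \<open>The SU(3) conditions inside \<open>Calabi_Yau\<close> are hypotheses, so only
      the closedness equations remain to be compared.\<close>
    unfolding formal_critical_point_iff[OF assms(6,2,16,3,8)] zero
    using assms(6) by (simp add: flat_connection_def Calabi_Yau_def)
qed

end
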